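(* Let $X$ be a directed space, $R$ a commutative ring and $n\ge 1$. Then $HA_n(X)$ is isomorphic, as an $R$-module, to the coproduct (direct sum) of the natural homology modules $HN_n(X)(p)$, for $p$ varying over any set of 1-traces of $X$ containing exactly one 1-trace from $a$ to $b$ for each pair $(a,b)\in X^2$ such that there is a d-path from $a$ to $b$.
   Context: A directed space (d-space) is a topological space $X$ with a set $dX$ of continuous paths $[0,1]\to X$ (the d-paths) containing all constant paths, closed under precomposition with continuous non-decreasing maps $[0,1]\to[0,1]$, and closed under concatenation. $\Delta_n=\{(t_0,\dots,t_n): t_j\ge 0,\ \sum_j t_j=1\}$ is the standard simplex, with face inclusions $\delta_k:\Delta_{n-1}\to\Delta_n$ (insert $0$ at position $k$) and degeneracies $\sigma_k:\Delta_n\to\Delta_{n-1}$, $0\le k<n$, $(t_0,\dots,t_n)\mapsto(t_0,\dots,t_k+t_{k+1},\dots,t_n)$. For $i\ge 1$, an $i$-path in $X$ is a continuous map $p:[0,1]\times\Delta_{i-1}\to X$ such that $p(\cdot,t)$ is a d-path for every $t\in\Delta_{i-1}$. For $a,b\in X$, an $i$-trace from $a$ to $b$ is a class of $i$-paths $p$ with $p(0,t)=a$ and $p(1,t)=b$ for all $t$, modulo reparametrization in the first coordinate (the equivalence relation generated by $p\sim p\circ(\varphi\times \mathrm{Id})$ with $\varphi:[0,1]\to[0,1]$ continuous, non-decreasing and surjective). $T_i(X)(a,b)$ is the set of $i$-traces from $a$ to $b$. The maps $d_j(p)=p\circ(\mathrm{Id}\times\delta_j)$ (from $(i+1)$-paths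 to $i$-paths, $0\le j\le i$) and $s_k(p)=p\circ(\mathrm{Id}\times\sigma_k)$ (from $i$-paths to $(i+1)$-paths, $0\le k\le i-1$) induce maps on traces preserving start and end points, and make $ST(X)(a,b)=(T_{i+1}(X)(a,b))_{i\ge 0}$ a simplicial set. Natural homology: for a 1-trace $p$ from $a$ to $b$ and $n\ge1$, $HN_n(X)(p)=H_{n-1}(ST(X)(a,b))$, the homology in degree $n-1$, with coefficients in $R$, of the unnormalized chain complex of the simplicial set $ST(X)(a,b)$. $R_i[X]$, $i\ge1$, is the free $R$-module on all $i$-traces of $X$, with bilinear product determined on basis elements by $p\times q=p*q$ (concatenation in the first coordinate) if the end point of $p$ is the start point of $q$, and $p\times q=0$ otherwise. Extending $d_j,s_k$ linearly, $R[X]=(R_{i+1}[X])_{i\ge0}$ (with $R_{i+1}[X]$ in degree $i$) is a simplicial object in the category of non-unital associative $R$-algebras. For a simplicial algebra $S$ with faces $d^n_j:S_n\to S_{n-1}$, its Moore normalization $NS$ is $(NS)_n=\bigcap_{j=0}^{n-1}\ker d^n_j$ with differential $\partial^n=(-1)^n d^n_n:(NS)_n\to(NS)_{n-1}$ (zero for $n=0$), and $H_n(NS)=\ker\partial^n/\mathrm{Im}\,\partial^{n+1}$. The directed homology algebras of $X$ are $HA_{n}(X)=H_{n-1}(NR[X])$ for $n\ge 1$. *)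

theory Defs
  imports "HOL-Homology.Homology" "HOL-Algebra.QuotRing"
begin

section \<open>Directed spaces and traces\<close>

text \<open>Maps out of \<open>[0,1]\<close> and \<open>[0,1] \<times> \<Delta>\<close> are represented by extensional functions, so that
  equality of functions is equality of maps.\<close>

locale d_space =
  fixes X :: "'a topology" and dX :: "(real \<Rightarrow> 'a) set"
  assumes dpath_continuous: "c \<in> dX \<Longrightarrow> pathin X c \<and> c \<in> extensional {0..1}"
    and dpath_const: "a \<in> topspace X \<Longrightarrow> (\<lambda>s\<in>{0..1}. a) \<in> dX"
    and dpath_reparam: "\<lbrakk>c \<in> dX; continuous_on {0..1} \<phi>; mono_on {0..1} \<phi>; \<phi> \<in> {0..1} \<rightarrow> {0..1}\<rbrakk>
      \<Longrightarrow> (\<lambda>s\<in>{0..1}. c (\<phi> s)) \<in> dX"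
    and dpath_concat: "\<lbrakk>c \<in> dX; c' \<in> dX; c 1 = c' 0\<rbrakk>
      \<Longrightarrow> (\<lambda>s\<in>{0..1}. if s \<le> 1/2 then c (2 * s) else c' (2 * s - 1)) \<in> dX"

type_synonym 'a ipath = "real \<times> (nat \<Rightarrow> real) \<Rightarrow> 'a"
type_synonym 'a trace = "'a ipath set"

text \<open>\<open>i\<close>-paths are indexed by \<open>i \<ge> 1\<close>; they are parametrized by the simplex of dimension
  \<open>i - 1\<close>.\<close>

abbreviation ipath_domain :: "nat \<Rightarrow> (real \<times> (nat \<Rightarrow> real)) set" where
  "ipath_domain i \<equiv> {0..1} \<times> standard_simplex (i - 1)"

definition ipaths :: "'a topology \<Rightarrow> (real \<Rightarrow> 'a) set \<Rightarrow> nat \<Rightarrow> 'a ipath set" where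
  "ipaths X dX i = {p \<in> extensional (ipath_domain i).
     continuous_map (prod_topology (top_of_set {0..1})
       (subtopology (powertop_real UNIV) (standard_simplex (i - 1)))) X p \<and>
     (\<forall>t \<in> standard_simplex (i - 1). (\<lambda>s\<in>{0..1}. p (s, t)) \<in> dX)}"

definition ipaths_between ::
    "'a topology \<Rightarrow> (real \<Rightarrow> 'a) set \<Rightarrow> nat \<Rightarrow> 'a \<Rightarrow> 'a \<Rightarrow> 'a ipath set" where
  "ipaths_between X dX i a b =
     {p \<in> ipaths X dX i. \<forall>t \<in> standard_simplex (i - 1). p (0, t) = a \<and> p (1, t) = b}"

definition reparam ::
    "'a topology \<Rightarrow> (real \<Rightarrow> 'a) set \<Rightarrow> nat \<Rightarrow> 'a ipath \<Rightarrow> 'a ipath \<Rightarrow> bool" where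
  "reparam X dX i p q \<longleftrightarrow> p \<in> ipaths X dX i \<and>
     (\<exists>\<phi>. continuous_on {0..1} \<phi> \<and> mono_on {0..1} \<phi> \<and> \<phi> ` {0..1::real} = {0..1} \<and>
       q = (\<lambda>(s, t)\<in>ipath_domain i. p (\<phi> s, t)))"

definition trace_of ::
    "'a topology \<Rightarrow> (real \<Rightarrow> 'a) set \<Rightarrow> nat \<Rightarrow> 'a ipath \<Rightarrow> 'a trace" where
  "trace_of X dX i p = {q. equivclp (reparam X dX i) p q}"

definition traces ::
    "'a topology \<Rightarrow> (real \<Rightarrow> 'a) set \<Rightarrow> nat \<Rightarrow> 'a \<Rightarrow> 'a \<Rightarrow> 'a trace set" where
  "traces X dX i a b = trace_of X dX i ` ipaths_between X dX i a b"

definition all_traces :: "'a topology \<Rightarrow> (real \<Rightarrow> 'a) set \<Rightarrow> nat \<Rightarrow> 'a trace set" where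
  "all_traces X dX i = (\<Union>a\<in>topspace X. \<Union>b\<in>topspace X. traces X dX i a b)"

definition trace_start :: "'a topology \<Rightarrow> (real \<Rightarrow> 'a) set \<Rightarrow> nat \<Rightarrow> 'a trace \<Rightarrow> 'a" where
  "trace_start X dX i P = (THE a. \<exists>b. P \<in> traces X dX i a b)"

definition trace_end :: "'a topology \<Rightarrow> (real \<Rightarrow> 'a) set \<Rightarrow> nat \<Rightarrow> 'a trace \<Rightarrow> 'a" where
  "trace_end X dX i P = (THE b. \<exists>a. P \<in> traces X dX i a b)"

definition simplex_degen :: "nat \<Rightarrow> (nat \<Rightarrow> real) \<Rightarrow> nat \<Rightarrow> real" where
  "simplex_degen k t = (\<lambda>j. if j < k then t j else if j = k then t k + t (Suc k) else t (Suc j))"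

text \<open>From \<open>(i+1)\<close>-paths to \<open>i\<close>-paths.\<close>

definition path_face :: "nat \<Rightarrow> nat \<Rightarrow> 'a ipath \<Rightarrow> 'a ipath" where
  "path_face i j p = (\<lambda>(s, t)\<in>ipath_domain i. p (s, simplical_face j t))"

text \<open>From \<open>i\<close>-paths to \<open>(i+1)\<close>-paths.\<close>

definition path_degen :: "nat \<Rightarrow> nat \<Rightarrow> 'a ipath \<Rightarrow> 'a ipath" where
  "path_degen i k p = (\<lambda>(s, t)\<in>ipath_domain (Suc i). p (s, simplex_degen k t))"

definition path_concat :: "nat \<Rightarrow> 'a ipath \<Rightarrow> 'a ipath \<Rightarrow> 'a ipath" where
  "path_concat i p q =
     (\<lambda>(s, t)\<in>ipath_domain i. if s \<le> 1/2 then p (2 * s, t) else q (2 * s - 1, t))"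

text \<open>An operation that respects reparametrization is induced on traces by taking the union of
  the classes of all its values (all these classes being equal).\<close>

definition trace_face ::
    "'a topology \<Rightarrow> (real \<Rightarrow> 'a) set \<Rightarrow> nat \<Rightarrow> nat \<Rightarrow> 'a trace \<Rightarrow> 'a trace" where
  "trace_face X dX i j P = (\<Union>p\<in>P. trace_of X dX i (path_face i j p))"

definition trace_degen ::
    "'a topology \<Rightarrow> (real \<Rightarrow> 'a) set \<Rightarrow> nat \<Rightarrow> nat \<Rightarrow> 'a trace \<Rightarrow> 'a trace" where
  "trace_degen X dX i k P = (\<Union>p\<in>P. trace_of X dX (Suc i) (path_degen i k p))"

definition trace_concat ::
    "'a topology \<Rightarrow> (real \<Rightarrow> 'a) set \<Rightarrow> nat \<Rightarrow> 'a trace \<Rightarrow> 'a trace \<Rightarrow> 'a trace" where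
  "trace_concat X dX i P Q = (\<Union>p\<in>P. \<Union>q\<in>Q. trace_of X dX i (path_concat i p q))"


section \<open>Modules\<close>

text \<open>Module records have a multiplication and a unit; these are left unspecified where only
  the module structure (or a non-unital algebra structure) is intended.\<close>

definition free_module :: "('r, 'e) ring_scheme \<Rightarrow> 'b set \<Rightarrow> ('r, 'b \<Rightarrow> 'r) module" where
  "free_module R B =
     \<lparr>carrier = {f \<in> B \<rightarrow>\<^sub>E carrier R. finite {b \<in> B. f b \<noteq> \<zero>\<^bsub>R\<^esub>}},
      mult = undefined, one = undefined,
      zero = (\<lambda>b\<in>B. \<zero>\<^bsub>R\<^esub>),
      add = (\<lambda>f g. \<lambda>b\<in>B. f b \<oplus>\<^bsub>R\<^esub> g b),
      smult = (\<lambda>r f. \<lambda>b\<in>B. r \<otimes>\<^bsub>R\<^esub> f b)\<rparr>"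

text \<open>Linear extension of a map of bases \<open>u : B \<rightarrow> B'\<close>.\<close>

definition free_map ::
    "('r, 'e) ring_scheme \<Rightarrow> 'b set \<Rightarrow> 'c set \<Rightarrow> ('b \<Rightarrow> 'c) \<Rightarrow> ('b \<Rightarrow> 'r) \<Rightarrow> ('c \<Rightarrow> 'r)" where
  "free_map R B B' u f = (\<lambda>c\<in>B'. \<Oplus>\<^bsub>R\<^esub>b\<in>{b \<in> B. f b \<noteq> \<zero>\<^bsub>R\<^esub> \<and> u b = c}. f b)"

definition quotient_module ::
    "('r, 'm, 'e) module_scheme \<Rightarrow> 'm set \<Rightarrow> ('r, 'm set) module" where
  "quotient_module M N =
     \<lparr>carrier = a_rcosets\<^bsub>M\<^esub> N,
      mult = rcoset_mult M N, one = undefined,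
      zero = N,
      add = set_add M,
      smult = (\<lambda>r A. \<Union>x\<in>A. N +>\<^bsub>M\<^esub> (r \<odot>\<^bsub>M\<^esub> x))\<rparr>"

definition direct_sum_module ::
    "'i set \<Rightarrow> ('i \<Rightarrow> ('r, 'm, 'e) module_scheme) \<Rightarrow> ('r, 'i \<Rightarrow> 'm) module" where
  "direct_sum_module I M =
     \<lparr>carrier = {x \<in> (\<Pi>\<^sub>E i\<in>I. carrier (M i)). finite {i \<in> I. x i \<noteq> \<zero>\<^bsub>M i\<^esub>}},
      mult = undefined, one = undefined,
      zero = (\<lambda>i\<in>I. \<zero>\<^bsub>M i\<^esub>),
      add = (\<lambda>x y. \<lambda>i\<in>I. x i \<oplus>\<^bsub>M i\<^esub> y i),
      smult = (\<lambda>r x. \<lambda>i\<in>I. r \<odot>\<^bsub>M i\<^esub> x i)\<rparr>"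

definition module_iso ::
    "('r, 'e) ring_scheme \<Rightarrow> ('r, 'm, 'f) module_scheme \<Rightarrow> ('r, 'n, 'g) module_scheme \<Rightarrow> ('m \<Rightarrow> 'n) set"
  where
  "module_iso R M N = {h \<in> iso (add_monoid M) (add_monoid N).
     \<forall>r \<in> carrier R. \<forall>x \<in> carrier M. h (r \<odot>\<^bsub>M\<^esub> x) = r \<odot>\<^bsub>N\<^esub> h x}"

definition isomorphic_modules ::
    "('r, 'e) ring_scheme \<Rightarrow> ('r, 'm, 'f) module_scheme \<Rightarrow> ('r, 'n, 'g) module_scheme \<Rightarrow> bool"
  where
  "isomorphic_modules R M N \<longleftrightarrow> module R M \<and> module R N \<and> module_iso R M N \<noteq> {}"


section \<open>Simplicial objects and their homology\<close>

text \<open>\<open>face n j\<close> goes from degree \<open>n\<close> to degree \<open>n - 1\<close> (\<open>n \<ge> 1\<close>, \<open>j \<le> n\<close>) and \<open>degen n k\<close> from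
  degree \<open>n\<close> to degree \<open>n + 1\<close> (\<open>k \<le> n\<close>).\<close>

record 'x simplicial_set =
  simplices :: "nat \<Rightarrow> 'x set"
  sset_face :: "nat \<Rightarrow> nat \<Rightarrow> 'x \<Rightarrow> 'x"
  sset_degen :: "nat \<Rightarrow> nat \<Rightarrow> 'x \<Rightarrow> 'x"

record ('r, 'm) simplicial_module =
  smod_obj :: "nat \<Rightarrow> ('r, 'm) module"
  smod_face :: "nat \<Rightarrow> nat \<Rightarrow> 'm \<Rightarrow> 'm"
  smod_degen :: "nat \<Rightarrow> nat \<Rightarrow> 'm \<Rightarrow> 'm"

definition linearization ::
    "('r, 'e) ring_scheme \<Rightarrow> 'x simplicial_set \<Rightarrow> ('r, 'x \<Rightarrow> 'r) simplicial_module" where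
  "linearization R S =
     \<lparr>smod_obj = (\<lambda>n. free_module R (simplices S n)),
      smod_face = (\<lambda>n j. free_map R (simplices S n) (simplices S (n - 1)) (sset_face S n j)),
      smod_degen = (\<lambda>n k. free_map R (simplices S n) (simplices S (Suc n)) (sset_degen S n k))\<rparr>"

text \<open>Homology of a chain complex concentrated in degrees \<open>n \<ge> 0\<close>; the differential
  \<open>D n : C n \<rightarrow> C (n - 1)\<close> is understood to be zero for \<open>n = 0\<close>, whatever \<open>D 0\<close> is.\<close>

definition cycles ::
    "(nat \<Rightarrow> ('r, 'm) module) \<Rightarrow> (nat \<Rightarrow> 'm \<Rightarrow> 'm) \<Rightarrow> nat \<Rightarrow> 'm set" where
  "cycles C D n = (if n = 0 then carrier (C 0) else a_kernel (C n) (C (n - 1)) (D n))"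

definition chain_homology ::
    "(nat \<Rightarrow> ('r, 'm) module) \<Rightarrow> (nat \<Rightarrow> 'm \<Rightarrow> 'm) \<Rightarrow> nat \<Rightarrow> ('r, 'm set) module" where
  "chain_homology C D n =
     quotient_module ((C n)\<lparr>carrier := cycles C D n\<rparr>) (D (Suc n) ` carrier (C (Suc n)))"

definition sgn_smult :: "('r, 'e) ring_scheme \<Rightarrow> ('r, 'm, 'f) module_scheme \<Rightarrow> nat \<Rightarrow> 'm \<Rightarrow> 'm" where
  "sgn_smult R M j x = ((\<ominus>\<^bsub>R\<^esub> \<one>\<^bsub>R\<^esub>) [^]\<^bsub>R\<^esub> j) \<odot>\<^bsub>M\<^esub> x"

definition unnormalized_differential ::
    "('r, 'e) ring_scheme \<Rightarrow> ('r, 'm) simplicial_module \<Rightarrow> nat \<Rightarrow> 'm \<Rightarrow> 'm" where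
  "unnormalized_differential R A n x =
     (\<Oplus>\<^bsub>smod_obj A (n - 1)\<^esub>j\<in>{..n}. sgn_smult R (smod_obj A (n - 1)) j (smod_face A n j x))"

definition simplicial_homology ::
    "('r, 'e) ring_scheme \<Rightarrow> 'x simplicial_set \<Rightarrow> nat \<Rightarrow> ('r, ('x \<Rightarrow> 'r) set) module" where
  "simplicial_homology R S n =
     chain_homology (smod_obj (linearization R S))
       (unnormalized_differential R (linearization R S)) n"

definition moore_obj :: "('r, 'm) simplicial_module \<Rightarrow> nat \<Rightarrow> ('r, 'm) module" where
  "moore_obj A n = (smod_obj A n)\<lparr>carrier :=
     {x \<in> carrier (smod_obj A n). \<forall>j<n. smod_face A n j x = \<zero>\<^bsub>smod_obj A (n - 1)\<^esub>}\<rparr>"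

definition moore_differential ::
    "('r, 'e) ring_scheme \<Rightarrow> ('r, 'm) simplicial_module \<Rightarrow> nat \<Rightarrow> 'm \<Rightarrow> 'm" where
  "moore_differential R A n x = sgn_smult R (smod_obj A (n - 1)) n (smod_face A n n x)"

definition moore_homology ::
    "('r, 'e) ring_scheme \<Rightarrow> ('r, 'm) simplicial_module \<Rightarrow> nat \<Rightarrow> ('r, 'm set) module" where
  "moore_homology R A n = chain_homology (moore_obj A) (moore_differential R A) n"


section \<open>Natural homology and homology algebras\<close>

definition trace_simplicial_set ::
    "'a topology \<Rightarrow> (real \<Rightarrow> 'a) set \<Rightarrow> (nat \<Rightarrow> 'a trace set) \<Rightarrow> 'a trace simplicial_set" where
  "trace_simplicial_set X dX T =
     \<lparr>simplices = (\<lambda>n. T (Suc n)),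
      sset_face = (\<lambda>n j. trace_face X dX n j),
      sset_degen = (\<lambda>n k. trace_degen X dX (Suc n) k)\<rparr>"

definition ST ::
    "'a topology \<Rightarrow> (real \<Rightarrow> 'a) set \<Rightarrow> 'a \<Rightarrow> 'a \<Rightarrow> 'a trace simplicial_set" where
  "ST X dX a b = trace_simplicial_set X dX (\<lambda>i. traces X dX i a b)"

definition HN ::
    "('r, 'e) ring_scheme \<Rightarrow> 'a topology \<Rightarrow> (real \<Rightarrow> 'a) set \<Rightarrow> nat \<Rightarrow> 'a trace
      \<Rightarrow> ('r, ('a trace \<Rightarrow> 'r) set) module" where
  "HN R X dX n P =
     simplicial_homology R (ST X dX (trace_start X dX 1 P) (trace_end X dX 1 P)) (n - 1)"

definition trace_algebra_mult ::
    "('r, 'e) ring_scheme \<Rightarrow> 'a topology \<Rightarrow> (real \<Rightarrow> 'a) set \<Rightarrow> nat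
      \<Rightarrow> ('a trace \<Rightarrow> 'r) \<Rightarrow> ('a trace \<Rightarrow> 'r) \<Rightarrow> ('a trace \<Rightarrow> 'r)" where
  "trace_algebra_mult R X dX i f g = (\<lambda>U\<in>all_traces X dX i.
     finsum R (\<lambda>(P, Q). f P \<otimes>\<^bsub>R\<^esub> g Q)
       {(P, Q). P \<in> all_traces X dX i \<and> f P \<noteq> \<zero>\<^bsub>R\<^esub> \<and>
                Q \<in> all_traces X dX i \<and> g Q \<noteq> \<zero>\<^bsub>R\<^esub> \<and>
                trace_end X dX i P = trace_start X dX i Q \<and> trace_concat X dX i P Q = U})"

text \<open>The simplicial algebra \<open>R[X]\<close>, with \<open>R\<^sub>n\<^sub>+\<^sub>1[X]\<close> in degree \<open>n\<close>.\<close>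

definition trace_simplicial_algebra ::
    "('r, 'e) ring_scheme \<Rightarrow> 'a topology \<Rightarrow> (real \<Rightarrow> 'a) set
      \<Rightarrow> ('r, 'a trace \<Rightarrow> 'r) simplicial_module" where
  "trace_simplicial_algebra R X dX =
     (let L = linearization R (trace_simplicial_set X dX (all_traces X dX))
      in L\<lparr>smod_obj := (\<lambda>n. (smod_obj L n)\<lparr>mult := trace_algebra_mult R X dX (Suc n)\<rparr>)\<rparr>)"

definition HA ::
    "('r, 'e) ring_scheme \<Rightarrow> 'a topology \<Rightarrow> (real \<Rightarrow> 'a) set \<Rightarrow> nat
      \<Rightarrow> ('r, ('a trace \<Rightarrow> 'r) set) module" where
  "HA R X dX n = moore_homology R (trace_simplicial_algebra R X dX) (n - 1)"

end

theory Submission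
  imports Defs
begin

text \<open>The end points of a trace are preserved by faces and degeneracies, so the simplicial set of all
  traces is the disjoint union of the simplicial sets \<open>ST(X)(a,b)\<close>, and \<open>S\<close> indexes the nonempty ones.
  Sending a Moore cycle of \<open>R[X]\<close> to the family of homology classes of its restrictions to the
  components is therefore linear with values in the direct sum. It is onto with the Moore boundaries as
  kernel because, componentwise, the Moore complex computes the homology of the unnormalized complex:
  replacing \<open>x\<close> by \<open>x - s\<^sub>k d\<^sub>k x\<close> for \<open>k = 0, 1, \<dots>\<close> kills one face after the other, changes a cycle by a
  boundary only, and does not change the boundary of \<open>x\<close> if that boundary is already normalized.\<close>

section \<open>Modules over a ring record\<close>

text \<open>On the Moore complex only the last term of the alternating sum survives, so the Moore
  differential is the restriction of the unnormalized one, and what remains is to compare cycles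
  modulo boundaries. The two halves are \<open>homology_class_normalized\<close> and
  \<open>homology_class_eq_zero_iff\<close>. Both rest on s_k being almost a contracting homotopy:
  if the faces of x below k vanish, then \<partial> s_k x + s_k \<partial> x = (-1)^k s_k d_k x.
  Such formulas are proved for alternating sums cut off after m terms, so that raising m by one adds
  a single cancelling pair and no double sum has to be reindexed. The obstacle on the side of the
  direct sum is finiteness. Representatives of classes, and chains with a given boundary, are chosen
  independently in each component; they glue to one element of the free module only if almost all of
  them are zero. Hence zero is always chosen where the given component is zero. The isomorphism is
  one of modules, so the records carrying the concatenation product are treated with an arbitrary
  product in their \<open>mult\<close> field.\<close>

lemma (in abelian_group) minus_eq_zero_iff:
  "\<lbrakk>x \<in> carrier G; y \<in> carrier G\<rbrakk> \<Longrightarrow> x \<ominus> y = \<zero> \<longleftrightarrow> x = y"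
  by (metis a_inv_closed a_minus_def minus_equality minus_minus r_neg)

lemma (in abelian_group) a_inv_zero: "\<ominus> \<zero> = \<zero>"
  by simp

text \<open>Only carriers, additions and scalar multiplications are compared, so the notion is
  stable under a change of the \<open>mult\<close> field, as happens when the free modules on traces
  become algebras.\<close>

definition rmodule_hom ::
    "('r, 'e) ring_scheme \<Rightarrow> ('r, 'm, 'f) module_scheme \<Rightarrow> ('r, 'n, 'g) module_scheme \<Rightarrow> ('m \<Rightarrow> 'n) set"
  where
  "rmodule_hom R M N = {h \<in> carrier M \<rightarrow> carrier N.
     (\<forall>x\<in>carrier M. \<forall>y\<in>carrier M. h (x \<oplus>\<^bsub>M\<^esub> y) = h x \<oplus>\<^bsub>N\<^esub> h y) \<and>
     (\<forall>r\<in>carrier R. \<forall>x\<in>carrier M. h (r \<odot>\<^bsub>M\<^esub> x) = r \<odot>\<^bsub>N\<^esub> h x)}"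

lemma rmodule_homI:
  assumes "\<And>x. x \<in> carrier M \<Longrightarrow> h x \<in> carrier N"
    and "\<And>x y. \<lbrakk>x \<in> carrier M; y \<in> carrier M\<rbrakk> \<Longrightarrow> h (x \<oplus>\<^bsub>M\<^esub> y) = h x \<oplus>\<^bsub>N\<^esub> h y"
    and "\<And>r x. \<lbrakk>r \<in> carrier R; x \<in> carrier M\<rbrakk> \<Longrightarrow> h (r \<odot>\<^bsub>M\<^esub> x) = r \<odot>\<^bsub>N\<^esub> h x"
  shows "h \<in> rmodule_hom R M N"
  using assms by (simp add: rmodule_hom_def)

lemma rmodule_homD:
  assumes "h \<in> rmodule_hom R M N"
  shows rmodule_hom_closed: "x \<in> carrier M \<Longrightarrow> h x \<in> carrier N"
    and rmodule_hom_add: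
      "\<lbrakk>x \<in> carrier M; y \<in> carrier M\<rbrakk> \<Longrightarrow> h (x \<oplus>\<^bsub>M\<^esub> y) = h x \<oplus>\<^bsub>N\<^esub> h y"
    and rmodule_hom_smult:
      "\<lbrakk>r \<in> carrier R; x \<in> carrier M\<rbrakk> \<Longrightarrow> h (r \<odot>\<^bsub>M\<^esub> x) = r \<odot>\<^bsub>N\<^esub> h x"
  using assms by (auto simp: rmodule_hom_def)

lemma rmodule_hom_group_hom:
  assumes "module R M" "module R N" "h \<in> rmodule_hom R M N"
  shows "abelian_group_hom M N h"
proof -
  interpret M: module R M by fact
  interpret N: module R N by fact
  show ?thesis
    by (intro abelian_group_homI M.abelian_group_axioms N.abelian_group_axioms group_hom.intro
        M.a_group N.a_group group_hom_axioms.intro homI)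
      (simp_all add: rmodule_homD[OF assms(3)])
qed

lemma rmodule_hom_zero:
  assumes "module R M" "module R N" "h \<in> rmodule_hom R M N"
  shows "h \<zero>\<^bsub>M\<^esub> = \<zero>\<^bsub>N\<^esub>"
  using abelian_group_hom.hom_zero[OF rmodule_hom_group_hom[OF assms]] .

lemma rmodule_hom_a_inv:
  assumes "module R M" "module R N" "h \<in> rmodule_hom R M N" "x \<in> carrier M"
  shows "h (\<ominus>\<^bsub>M\<^esub> x) = \<ominus>\<^bsub>N\<^esub> h x"
  using abelian_group_hom.hom_a_inv[OF rmodule_hom_group_hom[OF assms(1-3)] assms(4)] .

lemma rmodule_hom_minus:
  assumes "module R M" "module R N" "h \<in> rmodule_hom R M N" "x \<in> carrier M" "y \<in> carrier M"
  shows "h (x \<ominus>\<^bsub>M\<^esub> y) = h x \<ominus>\<^bsub>N\<^esub> h y"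
proof -
  interpret M: module R M by fact
  show ?thesis
    using assms by (simp add: a_minus_def rmodule_hom_add[OF assms(3)] rmodule_hom_a_inv)
qed

text \<open>The locale \<open>module\<close> looks at the additive group and the scalar
  multiplication of its second argument. This transports results on free modules to the records of
  R[X].\<close>

lemma module_mult_update [simp]: "module R (M\<lparr>mult := \<mu>\<rparr>) \<longleftrightarrow> module R M"
  by (simp add: module_def abelian_group_def abelian_monoid_def abelian_group_axioms_def
      module_axioms_def)

context module
begin

lemma sgn_smult_closed [simp]: "x \<in> carrier M \<Longrightarrow> sgn_smult R M j x \<in> carrier M"
  by (simp add: sgn_smult_def)

lemma sgn_smult_r_zero [simp]: "sgn_smult R M j \<zero>\<^bsub>M\<^esub> = \<zero>\<^bsub>M\<^esub>"
  by (simp add: sgn_smult_def)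

lemma sgn_smult_0 [simp]: "x \<in> carrier M \<Longrightarrow> sgn_smult R M 0 x = x"
  by (simp add: sgn_smult_def)

lemma sgn_smult_add:
  "\<lbrakk>x \<in> carrier M; y \<in> carrier M\<rbrakk>
    \<Longrightarrow> sgn_smult R M j (x \<oplus>\<^bsub>M\<^esub> y) = sgn_smult R M j x \<oplus>\<^bsub>M\<^esub> sgn_smult R M j y"
  by (simp add: sgn_smult_def smult_r_distr)

lemma sgn_smult_a_inv:
  "x \<in> carrier M \<Longrightarrow> sgn_smult R M j (\<ominus>\<^bsub>M\<^esub> x) = \<ominus>\<^bsub>M\<^esub> sgn_smult R M j x"
  by (simp add: sgn_smult_def smult_r_minus)

lemma sgn_smult_Suc:
  "x \<in> carrier M \<Longrightarrow> sgn_smult R M (Suc j) x = \<ominus>\<^bsub>M\<^esub> sgn_smult R M j x"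
  by (simp add: sgn_smult_def smult_l_minus smult_assoc1 R.r_minus)

text \<open>A sign is its own inverse; so signs can be cleared from the homotopy formulas, and a
  signed face vanishes exactly when the face does.\<close>

lemma sgn_smult_twice [simp]:
  "x \<in> carrier M \<Longrightarrow> sgn_smult R M j (sgn_smult R M j x) = x"
  by (induction j) (simp_all add: sgn_smult_Suc sgn_smult_a_inv)

lemma sgn_smult_eq_zero_iff:
  "x \<in> carrier M \<Longrightarrow> sgn_smult R M j x = \<zero>\<^bsub>M\<^esub> \<longleftrightarrow> x = \<zero>\<^bsub>M\<^esub>"
  by (metis sgn_smult_r_zero sgn_smult_twice)

text \<open>The scalar multiplication of the quotient takes a union over a coset. As N is stable
  under scalars, all members of the coset contribute the same coset and the union collapses to it;
  the module laws are then inherited from M.\<close>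

lemma quotient_module_hom:
  assumes "submodule N R M"
  shows quotient_module_module: "module R (quotient_module M N)"
    and r_coset_rmodule_hom: "(\<lambda>x. N +>\<^bsub>M\<^esub> x) \<in> rmodule_hom R M (quotient_module M N)"
proof -
  let ?Q = "quotient_module M N"
  have sub: "additive_subgroup N M"
    using assms by (simp add: additive_subgroup_def submodule_def)
  interpret N: abelian_subgroup N M
    by (rule abelian_subgroupI3[OF sub]) unfold_locales
  have carrier_Q: "carrier ?Q = (\<lambda>x. N +>\<^bsub>M\<^esub> x) ` carrier M"
    by (auto simp: quotient_module_def A_RCOSETS_def')
  have add_Q: "(N +>\<^bsub>M\<^esub> x) \<oplus>\<^bsub>?Q\<^esub> (N +>\<^bsub>M\<^esub> y) = N +>\<^bsub>M\<^esub> (x \<oplus>\<^bsub>M\<^esub> y)"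
    if "x \<in> carrier M" "y \<in> carrier M" for x y
    using that by (simp add: quotient_module_def N.a_rcos_sum)
  have smult_Q: "r \<odot>\<^bsub>?Q\<^esub> (N +>\<^bsub>M\<^esub> x) = N +>\<^bsub>M\<^esub> (r \<odot>\<^bsub>M\<^esub> x)"
    if r: "r \<in> carrier R" and x: "x \<in> carrier M" for r x
  proof -
    have "N +>\<^bsub>M\<^esub> (r \<odot>\<^bsub>M\<^esub> y) = N +>\<^bsub>M\<^esub> (r \<odot>\<^bsub>M\<^esub> x)" if y: "y \<in> N +>\<^bsub>M\<^esub> x" for y
    proof -
      obtain h where h: "h \<in> N" "y = h \<oplus>\<^bsub>M\<^esub> x"
        using y by (auto simp: a_r_coset_def')
      have "r \<odot>\<^bsub>M\<^esub> y = r \<odot>\<^bsub>M\<^esub> h \<oplus>\<^bsub>M\<^esub> r \<odot>\<^bsub>M\<^esub> x"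
        using h r x N.a_Hcarr by (simp add: smult_r_distr)
      moreover have "r \<odot>\<^bsub>M\<^esub> h \<in> N"
        using assms h r by (simp add: submodule.smult_closed)
      ultimately have "r \<odot>\<^bsub>M\<^esub> y \<in> N +>\<^bsub>M\<^esub> (r \<odot>\<^bsub>M\<^esub> x)"
        by (auto simp: a_r_coset_def')
      then show ?thesis
        using a_repr_independence[OF _ _ N.a_subgroup] r x by simp
    qed
    then have "(\<Union>y\<in>N +>\<^bsub>M\<^esub> x. N +>\<^bsub>M\<^esub> (r \<odot>\<^bsub>M\<^esub> y)) = (\<Union>y\<in>N +>\<^bsub>M\<^esub> x. N +>\<^bsub>M\<^esub> (r \<odot>\<^bsub>M\<^esub> x))"
      by (rule SUP_cong[OF refl])
    \<comment> \<open>A union of a constant family equals that constant only over a nonempty index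
      set.\<close>
    moreover have "N +>\<^bsub>M\<^esub> x \<noteq> {}"
      using N.a_rcos_self[OF x] by blast
    ultimately show ?thesis
      by (simp add: quotient_module_def)
  qed
  have zero_Q: "\<zero>\<^bsub>?Q\<^esub> = N +>\<^bsub>M\<^esub> \<zero>\<^bsub>M\<^esub>"
    using N.a_subset by (simp add: quotient_module_def)
  show "module R ?Q"
  proof (rule moduleI)
    show "abelian_group ?Q"
    proof (rule abelian_groupI)
      fix x assume "x \<in> carrier ?Q"
      then obtain a where "a \<in> carrier M" "x = N +>\<^bsub>M\<^esub> a"
        by (auto simp: carrier_Q)
      then show "\<exists>y\<in>carrier ?Q. y \<oplus>\<^bsub>?Q\<^esub> x = \<zero>\<^bsub>?Q\<^esub>"
        by (intro bexI[of _ "N +>\<^bsub>M\<^esub> (\<ominus>\<^bsub>M\<^esub> a)"]) (simp_all add: add_Q carrier_Q M.l_neg zero_Q)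
    qed (auto simp: carrier_Q add_Q zero_Q M.a_ac)
  qed (auto simp: carrier_Q add_Q smult_Q smult_l_distr smult_r_distr smult_assoc1 R.cring_axioms)
  show "(\<lambda>x. N +>\<^bsub>M\<^esub> x) \<in> rmodule_hom R M ?Q"
    by (rule rmodule_homI) (simp_all add: carrier_Q add_Q smult_Q)
qed

lemma r_coset_eq_iff:
  assumes "submodule N R M" "x \<in> carrier M"
  shows "N +>\<^bsub>M\<^esub> x = N \<longleftrightarrow> x \<in> N"
  using assms a_coset_join1 a_coset_join2 by (auto simp: submodule_def)

end

lemma submodule_a_kernel:
  assumes "module R M" "module R N" "h \<in> rmodule_hom R M N"
  shows "submodule (a_kernel M N h) R M"
proof -
  interpret M: module R M by fact
  interpret N: module R N by fact
  show ?thesis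
    using rmodule_hom_zero[OF assms] rmodule_hom_a_inv[OF assms]
    by (intro M.submoduleI) (auto simp: a_kernel_def' rmodule_homD[OF assms(3)])
qed

text \<open>The kernel is named by a separate K, so that the quotient can be formed by an explicitly
  described set such as the Moore boundaries. Well-definedness and injectivity of the induced map
  are the two directions of \<open>coset_eq\<close>.\<close>

lemma first_isomorphism_module:
  assumes "module R M" "module R N" and h: "h \<in> rmodule_hom R M N"
    and surj: "h ` carrier M = carrier N" and ker: "a_kernel M N h = K"
  shows "isomorphic_modules R (quotient_module M K) N"
proof -
  interpret M: module R M by fact
  interpret N: module R N by fact
  let ?Q = "quotient_module M K"
  have sub: "submodule K R M"
    using submodule_a_kernel[OF assms(1-3)] ker by simp
  then interpret K: abelian_subgroup K M
    by (intro abelian_subgroupI3) (simp_all add: additive_subgroup_def submodule_def M.abelian_group_axioms)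
  interpret Q: module R ?Q
    by (rule M.quotient_module_module[OF sub])
  have \<pi>: "(\<lambda>x. K +>\<^bsub>M\<^esub> x) \<in> rmodule_hom R M ?Q"
    by (rule M.r_coset_rmodule_hom[OF sub])
  have carrier_Q: "carrier ?Q = (\<lambda>x. K +>\<^bsub>M\<^esub> x) ` carrier M"
    by (auto simp: quotient_module_def A_RCOSETS_def')
  have coset_eq: "K +>\<^bsub>M\<^esub> x = K +>\<^bsub>M\<^esub> y \<longleftrightarrow> h x = h y" if "x \<in> carrier M" "y \<in> carrier M" for x y
  proof -
    have "K +>\<^bsub>M\<^esub> x = K +>\<^bsub>M\<^esub> y \<longleftrightarrow> x \<ominus>\<^bsub>M\<^esub> y \<in> K"
    proof -
      have "K +>\<^bsub>M\<^esub> x = K +>\<^bsub>M\<^esub> y \<longleftrightarrow> K +>\<^bsub>M\<^esub> (x \<ominus>\<^bsub>M\<^esub> y) = K"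
        unfolding a_minus_def
        using M.a_coset_add_inv1[OF _ that K.a_subset] M.a_coset_add_inv2[OF _ that K.a_subset]
        by blast
      then show ?thesis
        using M.r_coset_eq_iff[OF sub M.minus_closed[OF that]] by blast
    qed
    also have "\<dots> \<longleftrightarrow> h x \<ominus>\<^bsub>N\<^esub> h y = \<zero>\<^bsub>N\<^esub>"
      using that rmodule_hom_minus[OF assms(1-3) that] unfolding ker[symmetric] a_kernel_def'
      by simp
    also have "\<dots> \<longleftrightarrow> h x = h y"
      using rmodule_hom_closed[OF h that(1)] rmodule_hom_closed[OF h that(2)]
      by (rule N.minus_eq_zero_iff)
    finally show ?thesis .
  qed
  \<comment> \<open>A coset is sent to the value of h at a chosen representative; by
    \<open>coset_eq\<close> the choice does not matter.\<close>
  define g where "g A = h (SOME x. x \<in> carrier M \<and> A = K +>\<^bsub>M\<^esub> x)" for A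
  have g: "g (K +>\<^bsub>M\<^esub> x) = h x" if "x \<in> carrier M" for x
  proof -
    define y where "y = (SOME y. y \<in> carrier M \<and> K +>\<^bsub>M\<^esub> x = K +>\<^bsub>M\<^esub> y)"
    have "y \<in> carrier M \<and> K +>\<^bsub>M\<^esub> x = K +>\<^bsub>M\<^esub> y"
      unfolding y_def by (rule someI_ex) (use that in blast)
    then show ?thesis
      using coset_eq[of x y] that unfolding g_def y_def[symmetric] by simp
  qed
  have "g \<in> iso (add_monoid ?Q) (add_monoid N)"
    unfolding iso_def bij_betw_def
  proof (intro CollectI conjI homI)
    show "inj_on g (carrier (add_monoid ?Q))"
      by (auto simp: inj_on_def carrier_Q g coset_eq)
    show "g ` carrier (add_monoid ?Q) = carrier (add_monoid N)"
      by (simp add: carrier_Q image_image g surj cong: image_cong_simp)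
  qed (auto simp: carrier_Q g rmodule_homD[OF h] rmodule_hom_add[OF \<pi>, symmetric])
  moreover have "g (r \<odot>\<^bsub>?Q\<^esub> A) = r \<odot>\<^bsub>N\<^esub> g A" if "r \<in> carrier R" "A \<in> carrier ?Q" for r A
    using that by (auto simp: carrier_Q g rmodule_homD[OF h] rmodule_hom_smult[OF \<pi>, symmetric])
  ultimately show ?thesis
    unfolding isomorphic_modules_def module_iso_def
    using Q.module_axioms N.module_axioms by blast
qed

text \<open>The laws hold coordinatewise; what needs care is that supports stay finite: the support
  of a sum lies in the union of the two supports, those of a scalar multiple and of a negative in
  the original one. It serves for sums of homology modules and, with all summands equal to R, for
  free modules.\<close>

lemma direct_sum_module_module:
  assumes "cring R" and M: "\<And>i. i \<in> I \<Longrightarrow> module R (M i)"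
  shows "module R (direct_sum_module I M)"
proof -
  let ?D = "direct_sum_module I M"
  note grp = module.axioms(2)[OF M]
  note grp_simps = abelian_groupE[OF grp] abelian_group.l_neg[OF grp]
    abelian_group.a_inv_closed[OF grp] abelian_monoid.r_zero[OF abelian_group.axioms(1)[OF grp]]
  have add_closed: "x \<oplus>\<^bsub>?D\<^esub> y \<in> carrier ?D" if "x \<in> carrier ?D" "y \<in> carrier ?D" for x y
  proof -
    have "{i \<in> I. x i \<oplus>\<^bsub>M i\<^esub> y i \<noteq> \<zero>\<^bsub>M i\<^esub>} \<subseteq> {i \<in> I. x i \<noteq> \<zero>\<^bsub>M i\<^esub>} \<union> {i \<in> I. y i \<noteq> \<zero>\<^bsub>M i\<^esub>}"
      using grp_simps by auto
    moreover have "finite ({i \<in> I. x i \<noteq> \<zero>\<^bsub>M i\<^esub>} \<union> {i \<in> I. y i \<noteq> \<zero>\<^bsub>M i\<^esub>})"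
      using that by (simp add: direct_sum_module_def)
    ultimately have "finite {i \<in> I. x i \<oplus>\<^bsub>M i\<^esub> y i \<noteq> \<zero>\<^bsub>M i\<^esub>}"
      by (rule finite_subset)
    then show ?thesis
      using that grp_simps(1) by (auto simp: direct_sum_module_def PiE_iff cong: conj_cong)
  qed
  have smult_closed: "r \<odot>\<^bsub>?D\<^esub> x \<in> carrier ?D" if "r \<in> carrier R" "x \<in> carrier ?D" for r x
  proof -
    have "{i \<in> I. r \<odot>\<^bsub>M i\<^esub> x i \<noteq> \<zero>\<^bsub>M i\<^esub>} \<subseteq> {i \<in> I. x i \<noteq> \<zero>\<^bsub>M i\<^esub>}"
      using module.smult_r_null[OF M] that by auto
    moreover have "finite {i \<in> I. x i \<noteq> \<zero>\<^bsub>M i\<^esub>}"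
      using that by (simp add: direct_sum_module_def)
    ultimately have "finite {i \<in> I. r \<odot>\<^bsub>M i\<^esub> x i \<noteq> \<zero>\<^bsub>M i\<^esub>}"
      by (rule finite_subset)
    then show ?thesis
      using that module.smult_closed[OF M]
      by (auto simp: direct_sum_module_def PiE_iff cong: conj_cong)
  qed
  show ?thesis
  proof (rule moduleI)
    show "abelian_group ?D"
    proof (rule abelian_groupI)
      fix x assume x: "x \<in> carrier ?D"
      have "{i \<in> I. \<ominus>\<^bsub>M i\<^esub> x i \<noteq> \<zero>\<^bsub>M i\<^esub>} \<subseteq> {i \<in> I. x i \<noteq> \<zero>\<^bsub>M i\<^esub>}"
        using abelian_group.a_inv_zero[OF grp] by auto
      moreover have "finite {i \<in> I. x i \<noteq> \<zero>\<^bsub>M i\<^esub>}"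
        using x by (simp add: direct_sum_module_def)
      ultimately have "finite {i \<in> I. \<ominus>\<^bsub>M i\<^esub> x i \<noteq> \<zero>\<^bsub>M i\<^esub>}"
        by (rule finite_subset)
      then show "\<exists>y\<in>carrier ?D. y \<oplus>\<^bsub>?D\<^esub> x = \<zero>\<^bsub>?D\<^esub>"
        using x grp_simps
        by (intro bexI[of _ "\<lambda>i\<in>I. \<ominus>\<^bsub>M i\<^esub> x i"])
          (auto simp: direct_sum_module_def PiE_iff fun_eq_iff cong: conj_cong)
    next
      show "\<zero>\<^bsub>?D\<^esub> \<oplus>\<^bsub>?D\<^esub> x = x" if "x \<in> carrier ?D" for x
        using that grp_simps
        by (auto simp: direct_sum_module_def fun_eq_iff PiE_iff extensional_def)
    qed (use add_closed grp_simps in \<open>auto simp: direct_sum_module_def fun_eq_iff PiE_iff\<close>)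
  next
    show "\<one>\<^bsub>R\<^esub> \<odot>\<^bsub>?D\<^esub> x = x" if "x \<in> carrier ?D" for x
      using that module.smult_one[OF M]
      by (auto simp: direct_sum_module_def fun_eq_iff PiE_iff extensional_def)
  qed (use assms(1) smult_closed module.smult_l_distr[OF M] module.smult_r_distr[OF M]
        module.smult_assoc1[OF M] in \<open>auto simp: direct_sum_module_def fun_eq_iff PiE_iff\<close>)
qed


section \<open>Normalization of simplicial modules\<close>

text \<open>When two truncated sums are lengthened together, this brings their two new terms next to
  each other, where they cancel.\<close>

lemma (in abelian_monoid) a_interchange:
  "\<lbrakk>x \<in> carrier G; y \<in> carrier G; z \<in> carrier G; w \<in> carrier G\<rbrakk>
    \<Longrightarrow> (x \<oplus> y) \<oplus> (z \<oplus> w) = (x \<oplus> z) \<oplus> (y \<oplus> w)"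
  by (simp add: a_ac)

text \<open>The usual identities, such as d_i d_j = d_(j-1) d_i for i < j, appear with indices
  raised by one, so that no subtraction of natural numbers occurs.\<close>

locale simplicial_rmodule =
  fixes R :: "('r, 'e) ring_scheme" and A :: "('r, 'm) simplicial_module"
  assumes obj_module: "module R (smod_obj A n)"
    and face_hom: "j \<le> Suc n
      \<Longrightarrow> smod_face A (Suc n) j \<in> rmodule_hom R (smod_obj A (Suc n)) (smod_obj A n)"
    and degen_hom: "k \<le> n
      \<Longrightarrow> smod_degen A n k \<in> rmodule_hom R (smod_obj A n) (smod_obj A (Suc n))"
    and face_face: "\<lbrakk>i \<le> j; j \<le> Suc n; x \<in> carrier (smod_obj A (Suc (Suc n)))\<rbrakk>
      \<Longrightarrow> smod_face A (Suc n) i (smod_face A (Suc (Suc n)) (Suc j) x) =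
          smod_face A (Suc n) j (smod_face A (Suc (Suc n)) i x)"
    and face_degen_less: "\<lbrakk>i \<le> k; k \<le> n; x \<in> carrier (smod_obj A (Suc n))\<rbrakk>
      \<Longrightarrow> smod_face A (Suc (Suc n)) i (smod_degen A (Suc n) (Suc k) x) =
          smod_degen A n k (smod_face A (Suc n) i x)"
    and face_degen_same: "\<lbrakk>k \<le> n; x \<in> carrier (smod_obj A n)\<rbrakk>
      \<Longrightarrow> smod_face A (Suc n) k (smod_degen A n k x) = x"
    and face_degen_Suc: "\<lbrakk>k \<le> n; x \<in> carrier (smod_obj A n)\<rbrakk>
      \<Longrightarrow> smod_face A (Suc n) (Suc k) (smod_degen A n k x) = x"
    and face_degen_greater: "\<lbrakk>k < j; j \<le> Suc n; x \<in> carrier (smod_obj A (Suc n))\<rbrakk>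
      \<Longrightarrow> smod_face A (Suc (Suc n)) (Suc j) (smod_degen A (Suc n) k x) =
          smod_degen A n k (smod_face A (Suc n) j x)"
begin

abbreviation obj where "obj \<equiv> smod_obj A"
abbreviation d where "d \<equiv> smod_face A"
abbreviation s where "s \<equiv> smod_degen A"
abbreviation sg where "sg n j x \<equiv> sgn_smult R (obj n) j x"
abbreviation bd where "bd \<equiv> unnormalized_differential R A"

sublocale ob: module R "obj n" for n
  by (rule obj_module)

lemmas d_closed [simp] = rmodule_hom_closed[OF face_hom]
lemmas s_closed [simp] = rmodule_hom_closed[OF degen_hom]
lemmas d_add = rmodule_hom_add[OF face_hom]
lemmas s_add = rmodule_hom_add[OF degen_hom]
lemmas d_zero [simp] = rmodule_hom_zero[OF obj_module obj_module face_hom]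
lemmas s_zero [simp] = rmodule_hom_zero[OF obj_module obj_module degen_hom]
lemmas d_a_inv = rmodule_hom_a_inv[OF obj_module obj_module face_hom]

lemma d_sg: "\<lbrakk>j \<le> Suc n; x \<in> carrier (obj (Suc n))\<rbrakk> \<Longrightarrow> d (Suc n) j (sg (Suc n) i x) = sg n i (d (Suc n) j x)"
  by (simp add: sgn_smult_def rmodule_hom_smult[OF face_hom])

lemma s_sg: "\<lbrakk>j \<le> n; x \<in> carrier (obj n)\<rbrakk> \<Longrightarrow> s n j (sg n i x) = sg (Suc n) i (s n j x)"
  by (simp add: sgn_smult_def rmodule_hom_smult[OF degen_hom])

section \<open>Alternating sums of faces cut off after m terms\<close>

text \<open>Here n is the target degree; m = n + 2 gives the whole boundary of an element of degree
  n + 1 (\<open>bd_eq\<close>). Leaving m free is what permits induction on the number of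
  terms.\<close>

definition partial_bd where
  "partial_bd n m x = (\<Oplus>\<^bsub>obj n\<^esub>j\<in>{..<m}. sg n j (d (Suc n) j x))"

lemma partial_bd_0 [simp]: "partial_bd n 0 x = \<zero>\<^bsub>obj n\<^esub>"
  by (simp add: partial_bd_def)

lemma partial_bd_Suc:
  assumes "m \<le> Suc n" "x \<in> carrier (obj (Suc n))"
  shows "partial_bd n (Suc m) x = partial_bd n m x \<oplus>\<^bsub>obj n\<^esub> sg n m (d (Suc n) m x)"
proof -
  have "(\<lambda>j. sg n j (d (Suc n) j x)) \<in> {..<m} \<rightarrow> carrier (obj n)"
    using assms by auto
  then show ?thesis
    using assms by (simp add: partial_bd_def lessThan_Suc ob.finsum_insert ob.a_comm)
qed

lemma partial_bd_closed [simp]: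
  "\<lbrakk>m \<le> Suc (Suc n); x \<in> carrier (obj (Suc n))\<rbrakk> \<Longrightarrow> partial_bd n m x \<in> carrier (obj n)"
  unfolding partial_bd_def by (rule ob.finsum_closed) auto

lemma bd_eq: "bd (Suc n) x = partial_bd n (Suc (Suc n)) x"
  by (simp add: unnormalized_differential_def partial_bd_def lessThan_Suc_atMost)

lemma partial_bd_zero_eq:
  "\<lbrakk>m \<le> Suc (Suc n); \<And>j. j < m \<Longrightarrow> d (Suc n) j x = \<zero>\<^bsub>obj n\<^esub>\<rbrakk> \<Longrightarrow> partial_bd n m x = \<zero>\<^bsub>obj n\<^esub>"
  unfolding partial_bd_def by (rule ob.add.finprod_one_eqI) simp

lemma partial_bd_hom:
  "m \<le> Suc (Suc n) \<Longrightarrow> partial_bd n m \<in> rmodule_hom R (obj (Suc n)) (obj n)"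
proof (induction m)
  case 0
  show ?case
    by (rule rmodule_homI) auto
next
  case (Suc m)
  note D = rmodule_homD[OF Suc.IH[OF Suc_leD[OF Suc.prems]]]
  show ?case
  proof (rule rmodule_homI)
    fix x y assume "x \<in> carrier (obj (Suc n))" "y \<in> carrier (obj (Suc n))"
    then show "partial_bd n (Suc m) (x \<oplus>\<^bsub>obj (Suc n)\<^esub> y) =
        partial_bd n (Suc m) x \<oplus>\<^bsub>obj n\<^esub> partial_bd n (Suc m) y"
      using Suc.prems by (simp add: partial_bd_Suc D d_add ob.sgn_smult_add ob.a_ac)
  next
    fix r x assume "r \<in> carrier R" "x \<in> carrier (obj (Suc n))"
    then show "partial_bd n (Suc m) (r \<odot>\<^bsub>obj (Suc n)\<^esub> x) = r \<odot>\<^bsub>obj n\<^esub> partial_bd n (Suc m) x"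
      using Suc.prems
      by (simp add: partial_bd_Suc D rmodule_hom_smult[OF face_hom] ob.smult_r_distr sgn_smult_def
          ob.R.m_comm flip: ob.smult_assoc1)
  qed (use Suc.prems in auto)
qed

lemmas partial_bd_add = rmodule_hom_add[OF partial_bd_hom]

lemma bd_hom: "bd (Suc n) \<in> rmodule_hom R (obj (Suc n)) (obj n)"
  using partial_bd_hom[of "Suc (Suc n)" n] by (simp add: bd_eq[abs_def])

lemmas bd_closed [simp] = rmodule_hom_closed[OF bd_hom]

lemma bd_sg: "x \<in> carrier (obj (Suc n)) \<Longrightarrow> bd (Suc n) (sg (Suc n) i x) = sg n i (bd (Suc n) x)"
  by (simp add: sgn_smult_def rmodule_hom_smult[OF bd_hom])

lemma partial_bd_sg:
  "\<lbrakk>m \<le> Suc (Suc n); x \<in> carrier (obj (Suc n))\<rbrakk>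
    \<Longrightarrow> partial_bd n m (sg (Suc n) i x) = sg n i (partial_bd n m x)"
  by (simp add: sgn_smult_def rmodule_hom_smult[OF partial_bd_hom])

text \<open>For j \<le> m the simplicial identity reads d_m d_j = d_j d_(m+1), and every index j < l
  of the sum satisfies j \<le> m.\<close>

lemma face_partial_bd:
  assumes "m \<le> Suc n" "l \<le> Suc m" "x \<in> carrier (obj (Suc (Suc n)))"
  shows "d (Suc n) m (partial_bd (Suc n) l x) = partial_bd n l (d (Suc (Suc n)) (Suc m) x)"
  using assms
proof (induction l)
  case (Suc l)
  then show ?case
    by (simp add: partial_bd_Suc d_add d_sg face_face)
qed simp

text \<open>With the full number of terms this is \<open>\<partial>\<partial> = 0\<close>; letting the inner sum have one term more than the
  outer one makes the induction on the number of terms go through.\<close>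

lemma partial_bd_partial_bd:
  assumes "m \<le> Suc (Suc n)" "x \<in> carrier (obj (Suc (Suc n)))"
  shows "partial_bd n m (partial_bd (Suc n) (Suc m) x) = \<zero>\<^bsub>obj n\<^esub>"
  using assms
proof (induction m)
  case (Suc m)
  let ?y = "d (Suc (Suc n)) (Suc m) x"
  have y: "?y \<in> carrier (obj (Suc n))"
    using Suc.prems by simp
  have "partial_bd n (Suc m) (partial_bd (Suc n) (Suc (Suc m)) x) =
      partial_bd n (Suc m) (partial_bd (Suc n) (Suc m) x) \<oplus>\<^bsub>obj n\<^esub>
      sg n (Suc m) (partial_bd n (Suc m) ?y)"
    using Suc.prems y
    by (simp add: partial_bd_Suc[of "Suc m" "Suc n"] partial_bd_add partial_bd_sg)
  \<comment> \<open>By the induction hypothesis only the outer term of index m remains; moving its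
    face through the inner sum with \<open>face_partial_bd\<close> gives the other summand with the
    opposite sign.\<close>
  also have "partial_bd n (Suc m) (partial_bd (Suc n) (Suc m) x) = sg n m (partial_bd n (Suc m) ?y)"
    using Suc.prems Suc.IH y by (simp add: partial_bd_Suc[of m n] face_partial_bd)
  finally show ?case
    using Suc.prems y by (simp add: ob.sgn_smult_Suc ob.r_neg)
qed simp

lemma bd_bd: "x \<in> carrier (obj (Suc (Suc n))) \<Longrightarrow> bd (Suc n) (bd (Suc (Suc n)) x) = \<zero>\<^bsub>obj n\<^esub>"
  by (simp add: bd_eq partial_bd_partial_bd)

text \<open>The terms below k vanish by d_j s_k = s_(k-1) d_j; those of index k and k + 1 are x with
  opposite signs.\<close>

lemma partial_bd_degen:
  assumes x: "x \<in> carrier (obj n)" and "k \<le> n"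
    and zero: "\<And>j. j < k \<Longrightarrow> d n j x = \<zero>\<^bsub>obj (n - 1)\<^esub>"
  shows "partial_bd n (Suc (Suc k)) (s n k x) = \<zero>\<^bsub>obj n\<^esub>"
proof -
  have "d (Suc n) j (s n k x) = \<zero>\<^bsub>obj n\<^esub>" if jk: "j < k" for j
  proof -
    obtain n' k' where "n = Suc n'" "k = Suc k'"
      using jk \<open>k \<le> n\<close> by (cases n; cases k) auto
    then show ?thesis
      using jk \<open>k \<le> n\<close> x zero[OF jk] by (simp add: face_degen_less)
  qed
  then show ?thesis
    using x \<open>k \<le> n\<close>
    by (simp add: partial_bd_Suc partial_bd_zero_eq face_degen_same face_degen_Suc ob.sgn_smult_Suc
        ob.r_neg)
qed

text \<open>For m = n + 2 this is the homotopy formula \<partial> s_k x + s_k \<partial> x = (-1)^k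
  s_k d_k x. For j > k the identity d_(j+1) s_k = s_k d_j matches the term j + 1 of the first sum
  with the term j of the second, with opposite signs; this is why the first sum is one term longer.
  At m = k + 1 the first sum is zero and the second is its last term.\<close>

lemma partial_bd_degen_add:
  assumes x: "x \<in> carrier (obj (Suc n))" and "k \<le> n"
    and zero: "\<And>j. j < k \<Longrightarrow> d (Suc n) j x = \<zero>\<^bsub>obj n\<^esub>"
    and "k < m" "m \<le> Suc (Suc n)"
  shows "partial_bd (Suc n) (Suc m) (s (Suc n) k x) \<oplus>\<^bsub>obj (Suc n)\<^esub> s n k (partial_bd n m x) =
    s n k (sg n k (d (Suc n) k x))"
proof -
  have "Suc k \<le> m" using \<open>k < m\<close> by simp
  then show ?thesis
    using \<open>m \<le> Suc (Suc n)\<close>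
  proof (induction m rule: dec_induct)
    case base
    have "partial_bd (Suc n) (Suc (Suc k)) (s (Suc n) k x) = \<zero>\<^bsub>obj (Suc n)\<^esub>"
      using partial_bd_degen[of x "Suc n" k] x zero \<open>k \<le> n\<close> by simp
    moreover have "partial_bd n (Suc k) x = sg n k (d (Suc n) k x)"
      using x zero \<open>k \<le> n\<close> by (simp add: partial_bd_Suc partial_bd_zero_eq)
    ultimately show ?case
      using x \<open>k \<le> n\<close> by simp
  next
    case (step m)
    let ?z = "s n k (d (Suc n) m x)"
    have z: "?z \<in> carrier (obj (Suc n))"
      using step x \<open>k \<le> n\<close> by simp
    have "partial_bd (Suc n) (Suc (Suc m)) (s (Suc n) k x) \<oplus>\<^bsub>obj (Suc n)\<^esub> s n k (partial_bd n (Suc m) x) =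
      (partial_bd (Suc n) (Suc m) (s (Suc n) k x) \<oplus>\<^bsub>obj (Suc n)\<^esub> sg (Suc n) (Suc m) ?z) \<oplus>\<^bsub>obj (Suc n)\<^esub>
      (s n k (partial_bd n m x) \<oplus>\<^bsub>obj (Suc n)\<^esub> sg (Suc n) m ?z)"
      using step x \<open>k \<le> n\<close>
      by (simp add: partial_bd_Suc[of "Suc m" "Suc n"] partial_bd_Suc[of m n] face_degen_greater s_add s_sg)
    also have "\<dots> = (partial_bd (Suc n) (Suc m) (s (Suc n) k x) \<oplus>\<^bsub>obj (Suc n)\<^esub> s n k (partial_bd n m x))
        \<oplus>\<^bsub>obj (Suc n)\<^esub> (sg (Suc n) (Suc m) ?z \<oplus>\<^bsub>obj (Suc n)\<^esub> sg (Suc n) m ?z)"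
      using step x \<open>k \<le> n\<close> z by (intro ob.a_interchange) simp_all
    also have "sg (Suc n) (Suc m) ?z \<oplus>\<^bsub>obj (Suc n)\<^esub> sg (Suc n) m ?z = \<zero>\<^bsub>obj (Suc n)\<^esub>"
      using z by (simp add: ob.sgn_smult_Suc ob.l_neg)
    finally show ?case
      using step x \<open>k \<le> n\<close> by simp
  qed
qed

text \<open>The counterpart for faces. For m \<ge> k the identity d_m d_k = d_k d_(m+1) makes the
  new terms cancel; at m = k the first sum vanishes because d_j d_k = d_(k-1) d_j for j < k.\<close>

lemma partial_bd_face_add:
  assumes x: "x \<in> carrier (obj (Suc (Suc n)))" and "k \<le> Suc n"
    and zero: "\<And>j. j < k \<Longrightarrow> d (Suc (Suc n)) j x = \<zero>\<^bsub>obj (Suc n)\<^esub>"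
    and "k \<le> m" "m \<le> Suc (Suc n)"
  shows "partial_bd n m (d (Suc (Suc n)) k x) \<oplus>\<^bsub>obj n\<^esub> d (Suc n) k (partial_bd (Suc n) (Suc m) x) =
    d (Suc n) k (sg (Suc n) k (d (Suc (Suc n)) k x))"
  using \<open>k \<le> m\<close> \<open>m \<le> Suc (Suc n)\<close>
proof (induction m rule: dec_induct)
  case base
  have "d (Suc n) j (d (Suc (Suc n)) k x) = \<zero>\<^bsub>obj n\<^esub>" if jk: "j < k" for j
  proof -
    obtain k' where "k = Suc k'"
      using jk by (cases k) auto
    then show ?thesis
      using jk \<open>k \<le> Suc n\<close> x zero[OF jk] by (simp add: face_face)
  qed
  then have "partial_bd n k (d (Suc (Suc n)) k x) = \<zero>\<^bsub>obj n\<^esub>"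
    using \<open>k \<le> Suc n\<close> by (simp add: partial_bd_zero_eq)
  moreover have "partial_bd (Suc n) (Suc k) x = sg (Suc n) k (d (Suc (Suc n)) k x)"
    using x zero \<open>k \<le> Suc n\<close> by (simp add: partial_bd_Suc partial_bd_zero_eq)
  ultimately show ?case
    using x \<open>k \<le> Suc n\<close> by simp
next
  case (step m)
  let ?z = "d (Suc n) m (d (Suc (Suc n)) k x)"
  have z: "?z \<in> carrier (obj n)"
    using step x \<open>k \<le> Suc n\<close> by simp
  have "partial_bd n (Suc m) (d (Suc (Suc n)) k x) \<oplus>\<^bsub>obj n\<^esub> d (Suc n) k (partial_bd (Suc n) (Suc (Suc m)) x) =
    (partial_bd n m (d (Suc (Suc n)) k x) \<oplus>\<^bsub>obj n\<^esub> sg n m ?z) \<oplus>\<^bsub>obj n\<^esub>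
    (d (Suc n) k (partial_bd (Suc n) (Suc m) x) \<oplus>\<^bsub>obj n\<^esub> sg n (Suc m) ?z)"
    using step x \<open>k \<le> Suc n\<close>
    by (simp add: partial_bd_Suc[of "Suc m" "Suc n"] partial_bd_Suc[of m n] face_face d_add d_sg)
  also have "\<dots> = (partial_bd n m (d (Suc (Suc n)) k x) \<oplus>\<^bsub>obj n\<^esub> d (Suc n) k (partial_bd (Suc n) (Suc m) x))
      \<oplus>\<^bsub>obj n\<^esub> (sg n m ?z \<oplus>\<^bsub>obj n\<^esub> sg n (Suc m) ?z)"
    using step x \<open>k \<le> Suc n\<close> z by (intro ob.a_interchange) simp_all
  also have "sg n m ?z \<oplus>\<^bsub>obj n\<^esub> sg n (Suc m) ?z = \<zero>\<^bsub>obj n\<^esub>"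
    using z by (simp add: ob.sgn_smult_Suc ob.r_neg)
  finally show ?case
    using step x \<open>k \<le> Suc n\<close> by simp
qed

section \<open>Killing faces by subtracting degenerate elements\<close>

text \<open>The face of index k of the correction is d_k x itself, as d_k s_k is the identity. For j
  < k it is s_(k-1) d_(k-1) d_j x = 0, so faces already killed stay zero.\<close>

lemma face_subtract_degen:
  assumes x: "x \<in> carrier (obj (Suc n))" and "k \<le> n"
    and zero: "\<And>j. j < k \<Longrightarrow> d (Suc n) j x = \<zero>\<^bsub>obj n\<^esub>"
    and "j < Suc k"
  shows "d (Suc n) j (x \<ominus>\<^bsub>obj (Suc n)\<^esub> s n k (d (Suc n) k x)) = \<zero>\<^bsub>obj n\<^esub>"
proof (cases "j = k")
  case True
  then show ?thesis
    using x \<open>k \<le> n\<close> by (simp add: a_minus_def d_add d_a_inv face_degen_same ob.r_neg)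
next
  case False
  with \<open>j < Suc k\<close> have "j < k" by simp
  then obtain n' k' where nk: "n = Suc n'" "k = Suc k'"
    using \<open>k \<le> n\<close> by (cases n; cases k) auto
  have "d n j (d (Suc n) k x) = \<zero>\<^bsub>obj n'\<^esub>"
    using x \<open>k \<le> n\<close> nk \<open>j < k\<close> zero[OF \<open>j < k\<close>] by (simp add: face_face)
  then have "d (Suc n) j (s n k (d (Suc n) k x)) = \<zero>\<^bsub>obj n\<^esub>"
    using x \<open>k \<le> n\<close> nk \<open>j < k\<close> by (simp add: face_degen_less)
  then show ?thesis
    using x \<open>k \<le> n\<close> \<open>j < k\<close> zero[OF \<open>j < k\<close>] by (simp add: a_minus_def d_add d_a_inv)
qed

text \<open>Induction on the number k of killed faces. At a cycle the homotopy formula exhibits the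
  correction s_k d_k z' as a boundary, so subtracting it preserves both the class and the cycle
  condition.\<close>

lemma cycle_homologous_normalized:
  assumes "z \<in> carrier (obj n)" and cyc: "n > 0 \<Longrightarrow> bd n z = \<zero>\<^bsub>obj (n - 1)\<^esub>"
  shows "\<exists>z' w. z' \<in> carrier (obj n) \<and> w \<in> carrier (obj (Suc n)) \<and> z = z' \<oplus>\<^bsub>obj n\<^esub> bd (Suc n) w \<and>
    (n > 0 \<longrightarrow> bd n z' = \<zero>\<^bsub>obj (n - 1)\<^esub>) \<and> (\<forall>j<n. d n j z' = \<zero>\<^bsub>obj (n - 1)\<^esub>)"
proof (cases n)
  case 0
  then show ?thesis
    using assms rmodule_hom_zero[OF obj_module obj_module bd_hom]
    by (intro exI[of _ z] exI[of _ "\<zero>\<^bsub>obj (Suc n)\<^esub>"]) simp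
next
  case (Suc m)
  have "\<exists>z' w. z' \<in> carrier (obj n) \<and> w \<in> carrier (obj (Suc n)) \<and> z = z' \<oplus>\<^bsub>obj n\<^esub> bd (Suc n) w \<and>
    bd n z' = \<zero>\<^bsub>obj m\<^esub> \<and> (\<forall>j<k. d n j z' = \<zero>\<^bsub>obj m\<^esub>)" if "k \<le> n" for k
    using that
  proof (induction k)
    case 0
    then show ?case
      using assms rmodule_hom_zero[OF obj_module obj_module bd_hom] Suc
      by (intro exI[of _ z] exI[of _ "\<zero>\<^bsub>obj (Suc n)\<^esub>"]) simp
  next
    case (Suc k)
    then obtain z' w where z': "z' \<in> carrier (obj n)" and w: "w \<in> carrier (obj (Suc n))"
      and zw: "z = z' \<oplus>\<^bsub>obj n\<^esub> bd (Suc n) w" and bd_z': "bd n z' = \<zero>\<^bsub>obj m\<^esub>"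
      and zero: "\<And>j. j < k \<Longrightarrow> d n j z' = \<zero>\<^bsub>obj m\<^esub>"
      by auto
    have k: "k \<le> m" using Suc.prems \<open>n = Suc m\<close> by simp
    define u where "u = s m k (d n k z')"
    \<comment> \<open>The sign cancels the factor (-1)^k of the homotopy formula, so that the
      boundary of v is exactly u.\<close>
    define v where "v = sg (Suc n) k (s n k z')"
    have v: "v \<in> carrier (obj (Suc n))" and u: "u \<in> carrier (obj n)"
      using z' k \<open>n = Suc m\<close> by (simp_all add: u_def v_def)
    have "bd (Suc n) (s n k z') \<oplus>\<^bsub>obj n\<^esub> s m k (bd n z') = s m k (sg m k (d n k z'))"
      using partial_bd_degen_add[of z' m k "Suc (Suc m)"] z' zero k \<open>n = Suc m\<close>
      by (simp add: bd_eq)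
    then have "bd (Suc n) (s n k z') = sg n k u"
      using z' k \<open>n = Suc m\<close> bd_z' by (simp add: u_def s_sg)
    then have bd_v: "bd (Suc n) v = u"
      using z' k \<open>n = Suc m\<close> u by (simp add: v_def bd_sg)
    have "bd n (z' \<ominus>\<^bsub>obj n\<^esub> u) = \<zero>\<^bsub>obj m\<^esub>"
    proof -
      have "bd n u = \<zero>\<^bsub>obj m\<^esub>"
        using bd_bd[of v m] v bd_v \<open>n = Suc m\<close> by simp
      then show ?thesis
        using z' u bd_z' rmodule_hom_minus[OF obj_module obj_module bd_hom[of m]] \<open>n = Suc m\<close>
        by (simp add: a_minus_def)
    qed
    moreover have "z = (z' \<ominus>\<^bsub>obj n\<^esub> u) \<oplus>\<^bsub>obj n\<^esub> bd (Suc n) (v \<oplus>\<^bsub>obj (Suc n)\<^esub> w)"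
      using z' u v w bd_v rmodule_hom_add[OF bd_hom[of n] v w] ob.l_neg[OF u]
      by (simp add: zw a_minus_def ob.a_assoc) (simp add: ob.l_neg flip: ob.a_assoc)
    moreover have "d n j (z' \<ominus>\<^bsub>obj n\<^esub> u) = \<zero>\<^bsub>obj m\<^esub>" if "j < Suc k" for j
      using face_subtract_degen[of z' m k j] z' k zero that \<open>n = Suc m\<close> by (simp add: u_def)
    ultimately show ?case
      using z' u v w
      by (intro exI[of _ "z' \<ominus>\<^bsub>obj n\<^esub> u"] exI[of _ "v \<oplus>\<^bsub>obj (Suc n)\<^esub> w"]) simp
  qed
  from this[of n] show ?thesis
    using Suc by auto
qed

text \<open>Here y' is not a cycle, so it is not automatic that subtracting s_k d_k y' leaves the
  boundary unchanged. The assumption that the boundary is normalized is what makes s_k d_k y' a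
  cycle.\<close>

lemma boundary_normalized:
  assumes "y \<in> carrier (obj (Suc n))" and norm: "\<And>j. j < n \<Longrightarrow> d n j (bd (Suc n) y) = \<zero>\<^bsub>obj (n - 1)\<^esub>"
  shows "\<exists>y'\<in>carrier (obj (Suc n)). bd (Suc n) y' = bd (Suc n) y \<and>
    (\<forall>j<Suc n. d (Suc n) j y' = \<zero>\<^bsub>obj n\<^esub>)"
proof -
  have "\<exists>y'\<in>carrier (obj (Suc n)). bd (Suc n) y' = bd (Suc n) y \<and>
    (\<forall>j<k. d (Suc n) j y' = \<zero>\<^bsub>obj n\<^esub>)" if "k \<le> Suc n" for k
    using that
  proof (induction k)
    case 0
    then show ?case using assms(1) by auto
  next
    case (Suc k)
    then obtain y' where y': "y' \<in> carrier (obj (Suc n))" and bd_y': "bd (Suc n) y' = bd (Suc n) y"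
      and zero: "\<And>j. j < k \<Longrightarrow> d (Suc n) j y' = \<zero>\<^bsub>obj n\<^esub>"
      by auto
    have k: "k \<le> n" using Suc.prems by simp
    define w where "w = d (Suc n) k y'"
    have w: "w \<in> carrier (obj n)"
      using y' k by (simp add: w_def)
    have w_zero: "d n j w = \<zero>\<^bsub>obj (n - 1)\<^esub>" if jk: "j < k" for j
    proof -
      obtain n' k' where "n = Suc n'" "k = Suc k'"
        using jk k by (cases n; cases k) auto
      then show ?thesis
        using jk k y' zero[OF jk] by (simp add: w_def face_face)
    qed
    have bd_w: "bd (Suc n) (s n k w) = \<zero>\<^bsub>obj n\<^esub>"
    \<comment> \<open>For k = n the assumption says nothing about the face of index n of the
      boundary, but then \<open>partial_bd_degen\<close> already covers all n + 2 terms of the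
      boundary of s_n w.\<close>
    proof (cases "k = n")
      case True
      then show ?thesis
        using partial_bd_degen[OF w k w_zero] by (simp add: bd_eq)
    next
      case False
      then obtain m where n: "n = Suc m" and km: "k \<le> m"
        using k by (cases n) auto
      have 1: "bd (Suc n) (s n k w) \<oplus>\<^bsub>obj n\<^esub> s m k (bd n w) = s m k (sg m k (d n k w))"
        using partial_bd_degen_add[of w m k "Suc (Suc m)"] w w_zero km n by (simp add: bd_eq)
      \<comment> \<open>As the face of index k of the boundary is zero, this identifies the boundary
        of w with (-1)^k d_k w; the second summand of identity \<open>1\<close> then equals its
        right-hand side, leaving the first one zero.\<close>
      have "bd n w \<oplus>\<^bsub>obj m\<^esub> d n k (bd (Suc n) y') = d n k (sg n k w)"
        using partial_bd_face_add[of y' m k "Suc (Suc m)"] y' zero km n by (simp add: bd_eq w_def)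
      then have "bd n w = sg m k (d n k w)"
        using n w km norm[of k] bd_y' by (simp add: d_sg)
      then show ?thesis
        using 1 n w km by (simp add: ob.add.l_cancel_one)
    qed
    have "bd (Suc n) (y' \<ominus>\<^bsub>obj (Suc n)\<^esub> s n k w) = bd (Suc n) y"
      using bd_y' bd_w w y' k rmodule_hom_minus[OF obj_module obj_module bd_hom[of n]] assms(1)
      by (simp add: a_minus_def)
    moreover have "d (Suc n) j (y' \<ominus>\<^bsub>obj (Suc n)\<^esub> s n k w) = \<zero>\<^bsub>obj n\<^esub>" if "j < Suc k" for j
      using face_subtract_degen[of y' n k j] y' k zero that by (simp add: w_def)
    ultimately show ?case
      using y' w k by (intro bexI[of _ "y' \<ominus>\<^bsub>obj (Suc n)\<^esub> s n k w"]) auto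
  qed
  from this[of "Suc n"] show ?thesis by simp
qed

section \<open>Moore cycles and boundaries inside the unnormalized complex\<close>

text \<open>The kernel of the Moore differential: its last face can be listed with the others
  because the sign is invertible. The guard reflects that the differential is zero in degree
  0.\<close>

definition normalized_cycles :: "nat \<Rightarrow> 'm set" where
  "normalized_cycles n = {x \<in> carrier (obj n). n > 0 \<longrightarrow> (\<forall>j\<le>n. d n j x = \<zero>\<^bsub>obj (n - 1)\<^esub>)}"

definition normalized_boundaries :: "nat \<Rightarrow> 'm set" where
  "normalized_boundaries n = (\<lambda>y. sg n (Suc n) (d (Suc n) (Suc n) y)) `
     {y \<in> carrier (obj (Suc n)). \<forall>j\<le>n. d (Suc n) j y = \<zero>\<^bsub>obj n\<^esub>}"

definition cycle_module :: "nat \<Rightarrow> ('r, 'm) module" where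
  "cycle_module n = (obj n)\<lparr>carrier := cycles obj bd n\<rparr>"

definition boundaries :: "nat \<Rightarrow> 'm set" where
  "boundaries n = bd (Suc n) ` carrier (obj (Suc n))"

lemma moore_homology_eq:
  "moore_homology R A n =
    quotient_module ((obj n)\<lparr>carrier := normalized_cycles n\<rparr>) (normalized_boundaries n)"
proof -
  have "cycles (moore_obj A) (moore_differential R A) n = normalized_cycles n"
  proof (cases n)
    case (Suc m)
    then show ?thesis
      by (auto simp: cycles_def normalized_cycles_def a_kernel_def' moore_obj_def
          moore_differential_def ob.sgn_smult_eq_zero_iff le_less)
  qed (simp add: cycles_def normalized_cycles_def moore_obj_def)
  moreover have "moore_differential R A (Suc n) ` carrier (moore_obj A (Suc n)) =
      normalized_boundaries n"
    by (simp add: normalized_boundaries_def moore_differential_def[abs_def] moore_obj_def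
        less_Suc_eq_le)
  ultimately show ?thesis
    by (simp add: moore_homology_def chain_homology_def) (simp add: moore_obj_def)
qed

lemma chain_homology_eq:
  "chain_homology obj bd n = quotient_module (cycle_module n) (boundaries n)"
  by (simp add: chain_homology_def cycle_module_def boundaries_def)

lemma submodule_normalized_cycles: "submodule (normalized_cycles n) R (obj n)"
proof (rule ob.submoduleI)
  show "normalized_cycles n \<subseteq> carrier (obj n)"
    by (auto simp: normalized_cycles_def)
next
  fix r x assume "r \<in> carrier R" "x \<in> normalized_cycles n"
  then show "r \<odot>\<^bsub>obj n\<^esub> x \<in> normalized_cycles n"
    by (cases n) (simp_all add: normalized_cycles_def rmodule_hom_smult[OF face_hom])
qed (cases n; simp add: normalized_cycles_def d_add d_a_inv)+

text \<open>For j \<le> n and n > 0, d_j d_(n+1) y = d_n d_j y, which is zero since d_j y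
  is.\<close>

lemma normalized_boundaries_subset: "normalized_boundaries n \<subseteq> normalized_cycles n"
proof
  fix x assume "x \<in> normalized_boundaries n"
  then obtain y where y: "y \<in> carrier (obj (Suc n))" "\<And>j. j \<le> n \<Longrightarrow> d (Suc n) j y = \<zero>\<^bsub>obj n\<^esub>"
    and x: "x = sg n (Suc n) (d (Suc n) (Suc n) y)"
    by (auto simp: normalized_boundaries_def)
  show "x \<in> normalized_cycles n"
  proof (cases n)
    case 0
    then show ?thesis using x y by (simp add: normalized_cycles_def)
  next
    case (Suc m)
    have "d (Suc m) j (d (Suc (Suc m)) (Suc (Suc m)) y) = \<zero>\<^bsub>obj m\<^esub>" if "j \<le> Suc m" for j
      using face_face[of j "Suc m" m y] that y Suc by simp
    then show ?thesis
      using x y Suc by (simp add: normalized_cycles_def d_sg)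
  qed
qed

lemma carrier_cycle_module:
  "carrier (cycle_module n) = {z \<in> carrier (obj n). n > 0 \<longrightarrow> bd n z = \<zero>\<^bsub>obj (n - 1)\<^esub>}"
  by (cases n) (auto simp: cycle_module_def cycles_def a_kernel_def')

lemma cycle_module_module: "module R (cycle_module n)"
proof -
  have "submodule (cycles obj bd n) R (obj n)"
    by (cases n) (simp_all add: cycles_def ob.carrier_is_submodule
        submodule_a_kernel[OF obj_module obj_module bd_hom])
  then show ?thesis
    unfolding cycle_module_def by (rule submodule.submodule_is_module[OF _ obj_module])
qed

lemma normalized_cycles_subset: "normalized_cycles n \<subseteq> carrier (cycle_module n)"
  by (cases n) (auto simp: normalized_cycles_def carrier_cycle_module bd_eq intro!: partial_bd_zero_eq)

lemma bd_in_cycle_module: "w \<in> carrier (obj (Suc n)) \<Longrightarrow> bd (Suc n) w \<in> carrier (cycle_module n)"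
  by (cases n) (simp_all add: carrier_cycle_module bd_bd)

lemma submodule_boundaries: "submodule (boundaries n) R (cycle_module n)"
proof -
  interpret C: module R "cycle_module n" by (rule cycle_module_module)
  have bd: "bd (Suc n) \<in> rmodule_hom R (obj (Suc n)) (cycle_module n)"
    using rmodule_homD[OF bd_hom] bd_in_cycle_module
    by (intro rmodule_homI) (simp_all add: cycle_module_def)
  note hom = rmodule_homD[OF bd] rmodule_hom_zero[OF obj_module cycle_module_module bd]
    rmodule_hom_a_inv[OF obj_module cycle_module_module bd]
  show ?thesis
  proof (rule C.submoduleI)
    show "\<zero>\<^bsub>cycle_module n\<^esub> \<in> boundaries n"
      unfolding boundaries_def using hom by (metis imageI ob.zero_closed)
  qed (auto simp: boundaries_def hom(1) hom(2,3,5)[symmetric])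
qed

lemma chain_homology_module: "module R (chain_homology obj bd n)"
  unfolding chain_homology_eq
  by (rule module.quotient_module_module[OF cycle_module_module submodule_boundaries])

lemma homology_class_hom:
  "(\<lambda>z. boundaries n +>\<^bsub>cycle_module n\<^esub> z) \<in> rmodule_hom R (cycle_module n) (chain_homology obj bd n)"
  unfolding chain_homology_eq
  by (rule module.r_coset_rmodule_hom[OF cycle_module_module submodule_boundaries])

text \<open>Surjectivity of the comparison from Moore cycles to unnormalized homology.\<close>

lemma homology_class_normalized:
  assumes "c \<in> carrier (chain_homology obj bd n)"
  shows "\<exists>z\<in>normalized_cycles n. c = boundaries n +>\<^bsub>cycle_module n\<^esub> z"
proof -
  interpret C: module R "cycle_module n" by (rule cycle_module_module)
  interpret H: module R "chain_homology obj bd n" by (rule chain_homology_module)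
  obtain z where z: "z \<in> carrier (cycle_module n)" and c: "c = boundaries n +>\<^bsub>cycle_module n\<^esub> z"
    using assms by (auto simp: chain_homology_eq quotient_module_def A_RCOSETS_def')
  obtain z' w where z': "z' \<in> carrier (obj n)" and w: "w \<in> carrier (obj (Suc n))"
    and zw: "z = z' \<oplus>\<^bsub>obj n\<^esub> bd (Suc n) w" and cyc: "n > 0 \<Longrightarrow> bd n z' = \<zero>\<^bsub>obj (n - 1)\<^esub>"
    and zero: "\<And>j. j < n \<Longrightarrow> d n j z' = \<zero>\<^bsub>obj (n - 1)\<^esub>"
    using cycle_homologous_normalized[of z n] z by (auto simp: carrier_cycle_module)
  have norm: "z' \<in> normalized_cycles n"
  proof (cases n)
    case (Suc m)
    \<comment> \<open>With the faces below n zero the boundary reduces to its last term, so the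
      cycle condition kills the last face too.\<close>
    have "bd n z' = sg m n (d n n z')"
      using z' zero Suc by (simp add: bd_eq partial_bd_Suc[of "Suc m"] partial_bd_zero_eq)
    then have "d n n z' = \<zero>\<^bsub>obj m\<^esub>"
      using cyc z' Suc by (simp add: ob.sgn_smult_eq_zero_iff)
    then show ?thesis
      using z' zero Suc by (auto simp: normalized_cycles_def le_less)
  qed (use z' in \<open>simp add: normalized_cycles_def\<close>)
  have z'_C: "z' \<in> carrier (cycle_module n)"
    using norm normalized_cycles_subset by blast
  have "c = (boundaries n +>\<^bsub>cycle_module n\<^esub> z') \<oplus>\<^bsub>chain_homology obj bd n\<^esub>
      (boundaries n +>\<^bsub>cycle_module n\<^esub> bd (Suc n) w)"
    using rmodule_hom_add[OF homology_class_hom z'_C bd_in_cycle_module[OF w]] c zw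
    by (simp add: cycle_module_def)
  moreover have "boundaries n +>\<^bsub>cycle_module n\<^esub> bd (Suc n) w = \<zero>\<^bsub>chain_homology obj bd n\<^esub>"
    using C.r_coset_eq_iff[OF submodule_boundaries bd_in_cycle_module[OF w]] w
    by (simp add: boundaries_def chain_homology_eq quotient_module_def)
  ultimately have "c = boundaries n +>\<^bsub>cycle_module n\<^esub> z'"
    using H.r_zero[OF rmodule_hom_closed[OF homology_class_hom z'_C]] by (simp only:)
  with norm show ?thesis ..
qed

text \<open>Injectivity of the comparison: if a Moore cycle is the boundary of some chain,
  \<open>boundary_normalized\<close> replaces that chain by one in the Moore complex, where the full
  differential is the Moore differential.\<close>

lemma homology_class_eq_zero_iff:
  assumes "z \<in> normalized_cycles n"
  shows "boundaries n +>\<^bsub>cycle_module n\<^esub> z = \<zero>\<^bsub>chain_homology obj bd n\<^esub> \<longleftrightarrow> z \<in> normalized_boundaries n"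
proof -
  interpret C: module R "cycle_module n" by (rule cycle_module_module)
  have bd_norm: "bd (Suc n) y = sg n (Suc n) (d (Suc n) (Suc n) y)"
    if "y \<in> carrier (obj (Suc n))" "\<And>j. j \<le> n \<Longrightarrow> d (Suc n) j y = \<zero>\<^bsub>obj n\<^esub>" for y
    using that by (simp add: bd_eq partial_bd_Suc[of "Suc n"] partial_bd_zero_eq)
  have "boundaries n +>\<^bsub>cycle_module n\<^esub> z = \<zero>\<^bsub>chain_homology obj bd n\<^esub> \<longleftrightarrow> z \<in> boundaries n"
    using C.r_coset_eq_iff[OF submodule_boundaries] assms normalized_cycles_subset
    by (auto simp: chain_homology_eq quotient_module_def)
  also have "\<dots> \<longleftrightarrow> z \<in> normalized_boundaries n"
  proof
    assume "z \<in> boundaries n"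
    then obtain y where y: "y \<in> carrier (obj (Suc n))" "z = bd (Suc n) y"
      by (auto simp: boundaries_def)
    moreover have "d n j z = \<zero>\<^bsub>obj (n - 1)\<^esub>" if "j < n" for j
      using assms that by (simp add: normalized_cycles_def)
    ultimately obtain y' where "y' \<in> carrier (obj (Suc n))" "bd (Suc n) y' = z"
      "\<forall>j<Suc n. d (Suc n) j y' = \<zero>\<^bsub>obj n\<^esub>"
      using boundary_normalized[of y n] by auto
    then show "z \<in> normalized_boundaries n"
      using bd_norm by (auto simp: normalized_boundaries_def less_Suc_eq_le)
  next
    assume "z \<in> normalized_boundaries n"
    then show "z \<in> boundaries n"
      using bd_norm by (auto simp: normalized_boundaries_def boundaries_def intro!: image_eqI)
  qed
  finally show ?thesis .
qed

end


section \<open>Linearization of simplicial sets\<close>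

text \<open>The summand is the base ring as a module over itself, with the ring product as scalar
  multiplication; thus the module laws come from those of direct sums.\<close>

lemma free_module_eq:
  "free_module R B = direct_sum_module B (\<lambda>_. \<lparr>carrier = carrier R, mult = mult R, one = one R,
     zero = zero R, add = add R, smult = mult R\<rparr>)"
  by (simp add: free_module_def direct_sum_module_def)

lemma free_module_simps:
  "\<zero>\<^bsub>free_module R B\<^esub> = (\<lambda>b\<in>B. \<zero>\<^bsub>R\<^esub>)"
  "f \<oplus>\<^bsub>free_module R B\<^esub> g = (\<lambda>b\<in>B. f b \<oplus>\<^bsub>R\<^esub> g b)"
  "r \<odot>\<^bsub>free_module R B\<^esub> f = (\<lambda>b\<in>B. r \<otimes>\<^bsub>R\<^esub> f b)"
  "f \<in> carrier (free_module R B) \<longleftrightarrow> f \<in> B \<rightarrow>\<^sub>E carrier R \<and> finite {b \<in> B. f b \<noteq> \<zero>\<^bsub>R\<^esub>}"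
  by (simp_all add: free_module_def)

context cring
begin

lemma free_module_module: "module R (free_module R B)"
proof -
  have "abelian_group \<lparr>carrier = carrier R, mult = mult R, one = one R, zero = zero R,
      add = add R, smult = mult R\<rparr>"
    by (rule abelian_groupI) (auto simp: a_ac intro: l_neg)
  then have "module R \<lparr>carrier = carrier R, mult = mult R, one = one R, zero = zero R, add = add R,
      smult = mult R\<rparr>"
    by (intro moduleI cring_axioms) (simp_all add: l_distr r_distr m_assoc)
  then show ?thesis
    unfolding free_module_eq by (intro direct_sum_module_module cring_axioms)
qed

text \<open>The index set in \<open>free_map\<close> depends on the support of f. Padding with zeros
  lets several functions be summed over one common finite set.\<close>

lemma free_map_superset:
  assumes "f \<in> carrier (free_module R B)" "finite F" "F \<subseteq> B" "{b \<in> B. f b \<noteq> \<zero>} \<subseteq> F" "c \<in> B'"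
  shows "free_map R B B' u f c = (\<Oplus>b\<in>{b \<in> F. u b = c}. f b)"
proof -
  have "(\<Oplus>b\<in>{b \<in> B. f b \<noteq> \<zero> \<and> u b = c}. f b) = (\<Oplus>b\<in>{b \<in> F. u b = c}. f b)"
    using assms by (intro add.finprod_mono_neutral_cong_left) (auto simp: free_module_simps)
  then show ?thesis
    using assms by (simp add: free_map_def)
qed

lemma free_map_hom:
  assumes u: "u \<in> B \<rightarrow> B'"
  shows "free_map R B B' u \<in> rmodule_hom R (free_module R B) (free_module R B')"
proof (rule rmodule_homI)
  fix f assume f: "f \<in> carrier (free_module R B)"
  have "{c \<in> B'. free_map R B B' u f c \<noteq> \<zero>} \<subseteq> u ` {b \<in> B. f b \<noteq> \<zero>}"
  proof clarify
    fix c assume c: "c \<in> B'" "free_map R B B' u f c \<noteq> \<zero>"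
    have "{b \<in> B. f b \<noteq> \<zero> \<and> u b = c} \<noteq> {}"
      using c by (intro notI) (simp add: free_map_def)
    then show "c \<in> u ` {b \<in> B. f b \<noteq> \<zero>}"
      by blast
  qed
  moreover have "finite (u ` {b \<in> B. f b \<noteq> \<zero>})"
    using f by (simp add: free_module_simps)
  ultimately have "finite {c \<in> B'. free_map R B B' u f c \<noteq> \<zero>}"
    by (rule finite_subset)
  moreover have "free_map R B B' u f \<in> B' \<rightarrow>\<^sub>E carrier R"
    using f by (auto simp: free_map_def free_module_simps intro!: finsum_closed)
  ultimately show "free_map R B B' u f \<in> carrier (free_module R B')"
    by (simp add: free_module_simps)
next
  fix f g assume f: "f \<in> carrier (free_module R B)" and g: "g \<in> carrier (free_module R B)"
  interpret F: module R "free_module R B" by (rule free_module_module)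
  \<comment> \<open>This set contains the supports of f, g and f + g, so all three sums can run over
    it.\<close>
  let ?F = "{b \<in> B. f b \<noteq> \<zero>} \<union> {b \<in> B. g b \<noteq> \<zero>}"
  have fin: "finite ?F"
    using f g by (simp add: free_module_simps)
  have carr: "f b \<in> carrier R" "g b \<in> carrier R" if "b \<in> B" for b
    using f g that by (auto simp: free_module_simps)
  have "free_map R B B' u (f \<oplus>\<^bsub>free_module R B\<^esub> g) c = free_map R B B' u f c \<oplus> free_map R B B' u g c"
    if "c \<in> B'" for c
  proof -
    have "free_map R B B' u (f \<oplus>\<^bsub>free_module R B\<^esub> g) c =
        (\<Oplus>b\<in>{b \<in> ?F. u b = c}. (f \<oplus>\<^bsub>free_module R B\<^esub> g) b)"
      using f g fin that F.M.a_closed[OF f g]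
      by (intro free_map_superset) (auto simp: free_module_simps(2))
    also have "\<dots> = (\<Oplus>b\<in>{b \<in> ?F. u b = c}. f b \<oplus> g b)"
      using carr by (intro finsum_cong') (auto simp: free_module_simps)
    also have "\<dots> = (\<Oplus>b\<in>{b \<in> ?F. u b = c}. f b) \<oplus> (\<Oplus>b\<in>{b \<in> ?F. u b = c}. g b)"
      using carr by (intro finsum_addf) auto
    also have "\<dots> = free_map R B B' u f c \<oplus> free_map R B B' u g c"
      using f g fin that by (subst (1 2) free_map_superset[where F = ?F]) auto
    finally show ?thesis .
  qed
  then show "free_map R B B' u (f \<oplus>\<^bsub>free_module R B\<^esub> g) =
      free_map R B B' u f \<oplus>\<^bsub>free_module R B'\<^esub> free_map R B B' u g"
    by (auto simp: fun_eq_iff free_module_simps(2)[of _ B'] free_map_def[of _ _ B'])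
next
  fix r f assume r: "r \<in> carrier R" and f: "f \<in> carrier (free_module R B)"
  interpret F: module R "free_module R B" by (rule free_module_module)
  let ?F = "{b \<in> B. f b \<noteq> \<zero>}"
  have fin: "finite ?F"
    using f by (simp add: free_module_simps)
  have fin': "finite {b \<in> ?F. u b = c}" for c
    using fin by (rule rev_finite_subset) auto
  have carr: "f b \<in> carrier R" if "b \<in> B" for b
    using f that by (auto simp: free_module_simps)
  have "free_map R B B' u (r \<odot>\<^bsub>free_module R B\<^esub> f) c = r \<otimes> free_map R B B' u f c"
    if "c \<in> B'" for c
  proof -
    have "free_map R B B' u (r \<odot>\<^bsub>free_module R B\<^esub> f) c =
        (\<Oplus>b\<in>{b \<in> ?F. u b = c}. (r \<odot>\<^bsub>free_module R B\<^esub> f) b)"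
      using f r fin that F.smult_closed[OF r f]
      by (intro free_map_superset) (auto simp: free_module_simps(3))
    also have "\<dots> = (\<Oplus>b\<in>{b \<in> ?F. u b = c}. r \<otimes> f b)"
      using carr r by (intro finsum_cong') (auto simp: free_module_simps)
    also have "\<dots> = r \<otimes> (\<Oplus>b\<in>{b \<in> ?F. u b = c}. f b)"
      using carr r fin' by (intro finsum_rdistr[symmetric]) auto
    also have "\<dots> = r \<otimes> free_map R B B' u f c"
      using f fin that by (subst free_map_superset[where F = ?F]) auto
    finally show ?thesis .
  qed
  then show "free_map R B B' u (r \<odot>\<^bsub>free_module R B\<^esub> f) = r \<odot>\<^bsub>free_module R B'\<^esub> free_map R B B' u f"
    by (auto simp: fun_eq_iff free_module_simps(3)[of _ B'] free_map_def[of _ _ B'])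
qed

text \<open>The fibre of the composite over e is split into the fibres of u over the points that v
  sends to e.\<close>

lemma free_map_comp:
  assumes u: "u \<in> B \<rightarrow> B'" and v: "v \<in> B' \<rightarrow> B''" and f: "f \<in> carrier (free_module R B)"
  shows "free_map R B' B'' v (free_map R B B' u f) = free_map R B B'' (\<lambda>b. v (u b)) f"
proof -
  let ?F = "{b \<in> B. f b \<noteq> \<zero>}"
  have fin: "finite ?F"
    using f by (simp add: free_module_simps)
  have fin': "finite {b \<in> ?F. u b = c}" for c
    using fin by (rule rev_finite_subset) auto
  have carr: "f b \<in> carrier R" if "b \<in> B" for b
    using f that by (auto simp: free_module_simps)
  have uf: "free_map R B B' u f \<in> carrier (free_module R B')"
    using rmodule_hom_closed[OF free_map_hom[OF u] f] .
  have val: "free_map R B B' u f c = (\<Oplus>b\<in>{b \<in> ?F. u b = c}. f b)" if "c \<in> B'" for c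
    using f fin that by (intro free_map_superset) auto
  have supp: "{c \<in> B'. free_map R B B' u f c \<noteq> \<zero>} \<subseteq> u ` ?F"
  proof clarify
    fix c assume c: "c \<in> B'" "free_map R B B' u f c \<noteq> \<zero>"
    have "{b \<in> ?F. u b = c} \<noteq> {}"
    proof
      assume empty: "{b \<in> ?F. u b = c} = {}"
      show False
        using c val[OF c(1)] unfolding empty by simp
    qed
    then show "c \<in> u ` ?F" by blast
  qed
  have "free_map R B' B'' v (free_map R B B' u f) e = free_map R B B'' (\<lambda>b. v (u b)) f e"
    if e: "e \<in> B''" for e
  proof -
    let ?C = "{c \<in> u ` ?F. v c = e}"
    have "free_map R B' B'' v (free_map R B B' u f) e = (\<Oplus>c\<in>?C. free_map R B B' u f c)"
      using uf fin u supp e by (intro free_map_superset) auto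
    also have "\<dots> = (\<Oplus>c\<in>?C. \<Oplus>b\<in>{b \<in> ?F. u b = c}. f b)"
    proof (rule finsum_cong'[OF refl])
      show "(\<lambda>c. \<Oplus>b\<in>{b \<in> ?F. u b = c}. f b) \<in> ?C \<rightarrow> carrier R"
        using carr by (auto intro!: finsum_closed)
    qed (rule val, use u in auto)
    also have "\<dots> = (\<Oplus>b\<in>(\<Union>c\<in>?C. {b \<in> ?F. u b = c}). f b)"
      using fin fin' carr
      by (intro add.finprod_UN_disjoint[symmetric]) (auto simp: pairwise_def disjnt_def)
    also have "(\<Union>c\<in>?C. {b \<in> ?F. u b = c}) = {b \<in> ?F. v (u b) = e}"
      by auto
    also have "(\<Oplus>b\<in>{b \<in> ?F. v (u b) = e}. f b) = free_map R B B'' (\<lambda>b. v (u b)) f e"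
      using f fin e by (intro free_map_superset[symmetric]) auto
    finally show ?thesis .
  qed
  then show ?thesis
    by (auto simp: fun_eq_iff free_map_def[of _ _ B''])
qed

lemma free_map_ident:
  assumes "\<And>b. b \<in> B \<Longrightarrow> u b = b" and f: "f \<in> carrier (free_module R B)"
  shows "free_map R B B u f = f"
proof
  fix c
  show "free_map R B B u f c = f c"
  proof (cases "c \<in> B")
    case True
    have "{b \<in> B. f b \<noteq> \<zero> \<and> u b = c} = (if f c = \<zero> then {} else {c})"
      using assms(1) True by auto
    then show ?thesis
      using True f by (auto simp: free_map_def free_module_simps PiE_iff finsum_insert)
  next
    case False
    then show ?thesis
      using f by (auto simp: free_map_def free_module_simps PiE_iff extensional_def)
  qed
qed

end

lemma free_map_cong:
  assumes "\<And>b. b \<in> B \<Longrightarrow> u b = v b"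
  shows "free_map R B B' u f = free_map R B B' v f"
proof -
  have "{b \<in> B. f b \<noteq> \<zero>\<^bsub>R\<^esub> \<and> u b = c} = {b \<in> B. f b \<noteq> \<zero>\<^bsub>R\<^esub> \<and> v b = c}" for c
    using assms by auto
  then show ?thesis
    by (simp add: free_map_def)
qed

locale simplicial_set =
  fixes K :: "'x simplicial_set"
  assumes face_in: "\<lbrakk>x \<in> simplices K (Suc n); j \<le> Suc n\<rbrakk> \<Longrightarrow> sset_face K (Suc n) j x \<in> simplices K n"
    and degen_in: "\<lbrakk>x \<in> simplices K n; k \<le> n\<rbrakk> \<Longrightarrow> sset_degen K n k x \<in> simplices K (Suc n)"
    and face_face: "\<lbrakk>i \<le> j; j \<le> Suc n; x \<in> simplices K (Suc (Suc n))\<rbrakk>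
      \<Longrightarrow> sset_face K (Suc n) i (sset_face K (Suc (Suc n)) (Suc j) x) =
          sset_face K (Suc n) j (sset_face K (Suc (Suc n)) i x)"
    and face_degen_less: "\<lbrakk>i \<le> k; k \<le> n; x \<in> simplices K (Suc n)\<rbrakk>
      \<Longrightarrow> sset_face K (Suc (Suc n)) i (sset_degen K (Suc n) (Suc k) x) =
          sset_degen K n k (sset_face K (Suc n) i x)"
    and face_degen_same: "\<lbrakk>k \<le> n; x \<in> simplices K n\<rbrakk>
      \<Longrightarrow> sset_face K (Suc n) k (sset_degen K n k x) = x"
    and face_degen_Suc: "\<lbrakk>k \<le> n; x \<in> simplices K n\<rbrakk>
      \<Longrightarrow> sset_face K (Suc n) (Suc k) (sset_degen K n k x) = x"
    and face_degen_greater: "\<lbrakk>k < j; j \<le> Suc n; x \<in> simplices K (Suc n)\<rbrakk>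
      \<Longrightarrow> sset_face K (Suc (Suc n)) (Suc j) (sset_degen K (Suc n) k x) =
          sset_degen K n k (sset_face K (Suc n) j x)"

text \<open>Functoriality of \<open>free_map\<close> carries each simplicial identity over from the
  basis.\<close>

lemma linearization_simplicial_rmodule:
  assumes "cring R" "simplicial_set K"
  shows "simplicial_rmodule R (linearization R K)"
proof -
  interpret R: cring R by fact
  interpret K: simplicial_set K by fact
  have face: "sset_face K (Suc n) j \<in> simplices K (Suc n) \<rightarrow> simplices K n" if "j \<le> Suc n" for n j
    using that K.face_in by auto
  have degen: "sset_degen K n k \<in> simplices K n \<rightarrow> simplices K (Suc n)" if "k \<le> n" for n k
    using that K.degen_in by auto
  note simps = linearization_def R.free_map_comp face degen
  show ?thesis
  proof (rule simplicial_rmodule.intro)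
    show "module R (smod_obj (linearization R K) n)" for n
      by (simp add: linearization_def R.free_module_module)
  next
    fix n i j x
    assume "i \<le> j" "j \<le> Suc n" "x \<in> carrier (smod_obj (linearization R K) (Suc (Suc n)))"
    then show "smod_face (linearization R K) (Suc n) i (smod_face (linearization R K) (Suc (Suc n)) (Suc j) x) =
        smod_face (linearization R K) (Suc n) j (smod_face (linearization R K) (Suc (Suc n)) i x)"
      by (simp add: simps) (rule free_map_cong, simp add: K.face_face)
  next
    fix n i k x
    assume "i \<le> k" "k \<le> n" "x \<in> carrier (smod_obj (linearization R K) (Suc n))"
    then show "smod_face (linearization R K) (Suc (Suc n)) i (smod_degen (linearization R K) (Suc n) (Suc k) x) =
        smod_degen (linearization R K) n k (smod_face (linearization R K) (Suc n) i x)"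
      by (simp add: simps) (rule free_map_cong, simp add: K.face_degen_less)
  next
    fix n j k x
    assume "k < j" "j \<le> Suc n" "x \<in> carrier (smod_obj (linearization R K) (Suc n))"
    then show "smod_face (linearization R K) (Suc (Suc n)) (Suc j) (smod_degen (linearization R K) (Suc n) k x) =
        smod_degen (linearization R K) n k (smod_face (linearization R K) (Suc n) j x)"
      by (simp add: simps) (rule free_map_cong, simp add: K.face_degen_greater)
  qed (simp_all add: simps R.free_map_hom R.free_map_ident K.face_degen_same K.face_degen_Suc)
qed

text \<open>Passes from a linearization to R[X]: the conditions of the locale speak of the module
  structures only.\<close>

lemma simplicial_rmodule_mult_update:
  assumes "simplicial_rmodule R A"
  shows "simplicial_rmodule R (A\<lparr>smod_obj := \<lambda>n. (smod_obj A n)\<lparr>mult := \<mu> n\<rparr>\<rparr>)"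
  using assms by (simp add: simplicial_rmodule_def rmodule_hom_def)


section \<open>Moore homology of a disjoint union\<close>

text \<open>The components use the face operator of L itself, as traces with fixed end points do;
  that faces stay inside a component is part of \<open>component\<close>.\<close>

locale simplicial_coproduct =
  fixes R :: "('r, 'e) ring_scheme" and L :: "'x simplicial_set"
    and I :: "'i set" and K :: "'i \<Rightarrow> 'x simplicial_set"
  assumes cring: "cring R"
    and total: "simplicial_set L"
    and component: "i \<in> I \<Longrightarrow> simplicial_set (K i)"
    and component_face: "i \<in> I \<Longrightarrow> sset_face (K i) = sset_face L"
    and union: "simplices L n = (\<Union>i\<in>I. simplices (K i) n)"
    and disjoint: "\<lbrakk>i \<in> I; j \<in> I; x \<in> simplices (K i) n; x \<in> simplices (K j) n\<rbrakk> \<Longrightarrow> i = j"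
begin

interpretation R: cring R by (rule cring)

abbreviation "FL n \<equiv> free_module R (simplices L n)"
abbreviation "FK i n \<equiv> free_module R (simplices (K i) n)"
abbreviation "res i n f \<equiv> restrict f (simplices (K i) n)"

lemma component_subset: "\<lbrakk>i \<in> I; x \<in> simplices (K i) n\<rbrakk> \<Longrightarrow> x \<in> simplices L n"
  using union by blast

section \<open>Restriction to components and gluing\<close>

lemma res_hom:
  assumes i: "i \<in> I"
  shows "res i n \<in> rmodule_hom R (FL n) (FK i n)"
proof (rule rmodule_homI)
  fix f assume f: "f \<in> carrier (FL n)"
  have "{x \<in> simplices (K i) n. res i n f x \<noteq> \<zero>\<^bsub>R\<^esub>} \<subseteq> {x \<in> simplices L n. f x \<noteq> \<zero>\<^bsub>R\<^esub>}"
    using component_subset[OF i] by auto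
  moreover have "finite {x \<in> simplices L n. f x \<noteq> \<zero>\<^bsub>R\<^esub>}"
    using f by (simp add: free_module_simps)
  ultimately have "finite {x \<in> simplices (K i) n. res i n f x \<noteq> \<zero>\<^bsub>R\<^esub>}"
    by (rule finite_subset)
  moreover have "res i n f \<in> simplices (K i) n \<rightarrow>\<^sub>E carrier R"
    using f component_subset[OF i] by (auto simp: free_module_simps)
  ultimately show "res i n f \<in> carrier (FK i n)"
    by (simp add: free_module_simps)
qed (auto simp: free_module_simps fun_eq_iff component_subset[OF i])

lemma res_zero: "i \<in> I \<Longrightarrow> res i n \<zero>\<^bsub>FL n\<^esub> = \<zero>\<^bsub>FK i n\<^esub>"
  by (rule rmodule_hom_zero[OF R.free_module_module R.free_module_module res_hom])

text \<open>The coefficient of a face at x collects the preimages of x. A preimage in another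
  component would have its face there as well, which disjointness excludes.\<close>

lemma res_face:
  assumes i: "i \<in> I" and j: "j \<le> Suc n" and f: "f \<in> carrier (FL (Suc n))"
  shows "res i n (smod_face (linearization R L) (Suc n) j f) =
    smod_face (linearization R (K i)) (Suc n) j (res i (Suc n) f)"
proof -
  interpret Ki: simplicial_set "K i" by (rule component[OF i])
  have supp: "{b \<in> simplices L (Suc n). f b \<noteq> \<zero>\<^bsub>R\<^esub> \<and> sset_face L (Suc n) j b = x} =
    {b \<in> simplices (K i) (Suc n). res i (Suc n) f b \<noteq> \<zero>\<^bsub>R\<^esub> \<and> sset_face (K i) (Suc n) j b = x}"
    (is "?A = ?B") if x: "x \<in> simplices (K i) n" for x
  proof
    show "?B \<subseteq> ?A"
      using component_subset[OF i] by (auto simp: component_face[OF i])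
    show "?A \<subseteq> ?B"
    proof clarify
      fix b assume b: "b \<in> simplices L (Suc n)" "f b \<noteq> \<zero>\<^bsub>R\<^esub>" "x = sset_face L (Suc n) j b"
      then obtain i' where i': "i' \<in> I" "b \<in> simplices (K i') (Suc n)"
        using union by blast
      then have "sset_face L (Suc n) j b \<in> simplices (K i') n"
        using simplicial_set.face_in[OF component] component_face j by metis
      with i' b x have "i' = i"
        using disjoint i by blast
      with i' b show "b \<in> simplices (K i) (Suc n) \<and> res i (Suc n) f b \<noteq> \<zero>\<^bsub>R\<^esub> \<and>
          sset_face (K i) (Suc n) j b = sset_face L (Suc n) j b"
        by (simp add: component_face[OF i])
    qed
  qed
  have sum: "finsum R f T = finsum R (res i (Suc n) f) T"
    if "T \<subseteq> simplices (K i) (Suc n)" for T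
  proof (rule R.finsum_cong'[OF refl, symmetric])
    show "f \<in> T \<rightarrow> carrier R"
      using f that component_subset[OF i] by (auto simp: free_module_simps PiE_iff)
    show "res i (Suc n) f x = f x" if "x \<in> T" for x
      using that \<open>T \<subseteq> simplices (K i) (Suc n)\<close> by auto
  qed
  show ?thesis
  proof
    fix x
    show "res i n (smod_face (linearization R L) (Suc n) j f) x =
        smod_face (linearization R (K i)) (Suc n) j (res i (Suc n) f) x"
    proof (cases "x \<in> simplices (K i) n")
      case True
      have "smod_face (linearization R L) (Suc n) j f x =
          finsum R f {b \<in> simplices L (Suc n). f b \<noteq> \<zero>\<^bsub>R\<^esub> \<and> sset_face L (Suc n) j b = x}"
        using component_subset[OF i True] by (simp add: linearization_def free_map_def)
      also have "\<dots> = finsum R (res i (Suc n) f) {b \<in> simplices (K i) (Suc n).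
          res i (Suc n) f b \<noteq> \<zero>\<^bsub>R\<^esub> \<and> sset_face (K i) (Suc n) j b = x}"
        unfolding supp[OF True] by (rule sum) blast
      also have "\<dots> = smod_face (linearization R (K i)) (Suc n) j (res i (Suc n) f) x"
        by (simp add: linearization_def free_map_def restrict_apply'[OF True] del: restrict_apply)
      finally show ?thesis
        using True by simp
    qed (simp add: linearization_def free_map_def)
  qed
qed

lemma res_sgn_smult:
  assumes "i \<in> I" "f \<in> carrier (FL n)"
  shows "res i n (sgn_smult R (FL n) k f) = sgn_smult R (FK i n) k (res i n f)"
  using assms by (simp add: sgn_smult_def rmodule_hom_smult[OF res_hom])

lemma coproduct_ext:
  assumes f: "f \<in> carrier (FL n)" and g: "g \<in> carrier (FL n)"
    and eq: "\<And>i. i \<in> I \<Longrightarrow> res i n f = res i n g"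
  shows "f = g"
proof
  fix x
  show "f x = g x"
  proof (cases "x \<in> simplices L n")
    case True
    then obtain i where "i \<in> I" "x \<in> simplices (K i) n"
      using union by blast
    then show ?thesis
      using eq by (metis restrict_apply')
  next
    case False
    then show ?thesis
      using f g by (auto simp: free_module_simps PiE_iff extensional_def)
  qed
qed

lemma face_eq_zero_iff:
  assumes f: "f \<in> carrier (FL (Suc n))" and j: "j \<le> Suc n"
  shows "smod_face (linearization R L) (Suc n) j f = \<zero>\<^bsub>FL n\<^esub> \<longleftrightarrow>
    (\<forall>i\<in>I. smod_face (linearization R (K i)) (Suc n) j (res i (Suc n) f) = \<zero>\<^bsub>FK i n\<^esub>)"
proof -
  interpret FL: module R "FL n" by (rule R.free_module_module)
  interpret L: simplicial_rmodule R "linearization R L"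
    by (intro linearization_simplicial_rmodule cring total)
  have "smod_face (linearization R L) (Suc n) j f \<in> carrier (FL n)"
    using L.d_closed[of j n f] f j by (simp add: linearization_def)
  then have "smod_face (linearization R L) (Suc n) j f = \<zero>\<^bsub>FL n\<^esub> \<longleftrightarrow>
      (\<forall>i\<in>I. res i n (smod_face (linearization R L) (Suc n) j f) = \<zero>\<^bsub>FK i n\<^esub>)"
    using coproduct_ext[OF _ FL.M.zero_closed] res_zero by auto
  then show ?thesis
    using f j by (simp add: res_face)
qed

definition idx :: "nat \<Rightarrow> 'x \<Rightarrow> 'i" where
  "idx n x = (THE i. i \<in> I \<and> x \<in> simplices (K i) n)"

lemma idx_eq: "\<lbrakk>i \<in> I; x \<in> simplices (K i) n\<rbrakk> \<Longrightarrow> idx n x = i"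
  unfolding idx_def using disjoint by blast

text \<open>A component where f is nonzero contains a point of its finite support, and
  \<open>idx\<close> recovers the component from that point.\<close>

lemma finite_res_nonzero:
  assumes f: "f \<in> carrier (FL n)"
  shows "finite {i \<in> I. res i n f \<noteq> \<zero>\<^bsub>FK i n\<^esub>}"
proof (rule finite_subset)
  show "{i \<in> I. res i n f \<noteq> \<zero>\<^bsub>FK i n\<^esub>} \<subseteq> idx n ` {x \<in> simplices L n. f x \<noteq> \<zero>\<^bsub>R\<^esub>}"
  proof clarify
    fix i assume i: "i \<in> I" and nz: "res i n f \<noteq> \<zero>\<^bsub>FK i n\<^esub>"
    then obtain x where x: "x \<in> simplices (K i) n" "f x \<noteq> \<zero>\<^bsub>R\<^esub>"
      by (auto simp: free_module_simps fun_eq_iff split: if_splits)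
    show "i \<in> idx n ` {x \<in> simplices L n. f x \<noteq> \<zero>\<^bsub>R\<^esub>}"
      using x i component_subset idx_eq by (intro image_eqI[of _ _ x]) auto
  qed
  show "finite (idx n ` {x \<in> simplices L n. f x \<noteq> \<zero>\<^bsub>R\<^esub>})"
    using f by (simp add: free_module_simps)
qed

text \<open>The support of the glued function is a union of finitely many finite supports; this is
  where finiteness of the family is spent.\<close>

lemma coproduct_glue:
  assumes y: "\<And>i. i \<in> I \<Longrightarrow> y i \<in> carrier (FK i n)" and fin: "finite {i \<in> I. y i \<noteq> \<zero>\<^bsub>FK i n\<^esub>}"
  shows "\<exists>f\<in>carrier (FL n). \<forall>i\<in>I. res i n f = y i"
proof
  let ?f = "\<lambda>x\<in>simplices L n. y (idx n x) x"
  show res: "\<forall>i\<in>I. res i n ?f = y i"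
  proof (intro ballI ext)
    fix i x assume i: "i \<in> I"
    show "res i n ?f x = y i x"
      using y[OF i] idx_eq[OF i, of x n] component_subset[OF i, of x n]
      by (cases "x \<in> simplices (K i) n") (simp_all add: free_module_simps PiE_iff extensional_def)
  qed
  have val: "?f x = y i x" if "i \<in> I" "x \<in> simplices (K i) n" for i x
    using idx_eq[OF that] component_subset[OF that] by simp
  have "{x \<in> simplices L n. ?f x \<noteq> \<zero>\<^bsub>R\<^esub>} \<subseteq>
    (\<Union>i\<in>{i \<in> I. y i \<noteq> \<zero>\<^bsub>FK i n\<^esub>}. {x \<in> simplices (K i) n. y i x \<noteq> \<zero>\<^bsub>R\<^esub>})"
  proof clarify
    fix x assume x: "x \<in> simplices L n" "?f x \<noteq> \<zero>\<^bsub>R\<^esub>"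
    then obtain i where i: "i \<in> I" "x \<in> simplices (K i) n"
      using union by blast
    then have nz: "y i x \<noteq> \<zero>\<^bsub>R\<^esub>"
      using val x by metis
    with i have "y i \<noteq> \<zero>\<^bsub>FK i n\<^esub>"
      by (auto simp: free_module_simps)
    with i nz show "x \<in> (\<Union>i\<in>{i \<in> I. y i \<noteq> \<zero>\<^bsub>FK i n\<^esub>}. {x \<in> simplices (K i) n. y i x \<noteq> \<zero>\<^bsub>R\<^esub>})"
      by blast
  qed
  moreover have "finite (\<Union>i\<in>{i \<in> I. y i \<noteq> \<zero>\<^bsub>FK i n\<^esub>}. {x \<in> simplices (K i) n. y i x \<noteq> \<zero>\<^bsub>R\<^esub>})"
  proof (rule finite_UN_I[OF fin])
    show "finite {x \<in> simplices (K i) n. y i x \<noteq> \<zero>\<^bsub>R\<^esub>}" if "i \<in> {i \<in> I. y i \<noteq> \<zero>\<^bsub>FK i n\<^esub>}" for i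
      using y[of i] that by (simp add: free_module_simps(4))
  qed
  ultimately have "finite {x \<in> simplices L n. ?f x \<noteq> \<zero>\<^bsub>R\<^esub>}"
    by (rule finite_subset)
  moreover have "?f x \<in> carrier R" if x: "x \<in> simplices L n" for x
  proof -
    obtain i where i: "i \<in> I" "x \<in> simplices (K i) n"
      using union x by blast
    show ?thesis
      unfolding val[OF i] using y[OF i(1)] i(2) by (simp add: free_module_simps(4) PiE_iff)
  qed
  ultimately show "?f \<in> carrier (FL n)"
    by (simp add: free_module_simps PiE_iff)
qed

text \<open>The products \<mu> stand for those of R[X]. Surjectivity of h and the description of its
  kernel both come from componentwise choices that are then glued.\<close>

theorem moore_homology_coproduct:
  fixes \<mu>
  defines "A \<equiv> (linearization R L)\<lparr>smod_obj := \<lambda>n. (smod_obj (linearization R L) n)\<lparr>mult := \<mu> n\<rparr>\<rparr>"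
  shows "isomorphic_modules R (moore_homology R A n)
    (direct_sum_module I (\<lambda>i. simplicial_homology R (K i) n))"
proof -
  let ?lin = "\<lambda>i. linearization R (K i)"
  interpret A: simplicial_rmodule R A
    unfolding A_def
    by (intro simplicial_rmodule_mult_update linearization_simplicial_rmodule cring total)
  have K: "simplicial_rmodule R (?lin i)" if "i \<in> I" for i
    using that by (intro linearization_simplicial_rmodule cring component)
  define NC where "NC i = simplicial_rmodule.normalized_cycles (?lin i) n" for i
  define NB where "NB i = simplicial_rmodule.normalized_boundaries R (?lin i) n" for i
  define H where "H i = simplicial_homology R (K i) n" for i
  define cls where "cls i z = simplicial_rmodule.boundaries R (?lin i) n
    +>\<^bsub>simplicial_rmodule.cycle_module R (?lin i) n\<^esub> z" for i z
  note defs = NC_def NB_def H_def cls_def simplicial_homology_def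
  have obj_A: "smod_obj A m = (FL m)\<lparr>mult := \<mu> m\<rparr>" and face_A: "smod_face A = smod_face (linearization R L)" for m
    by (simp_all add: A_def linearization_def)
  have obj_K [simp]: "smod_obj (?lin i) m = FK i m" for i m
    by (simp add: linearization_def)
  have mod_H: "module R (H i)" if "i \<in> I" for i
    unfolding defs by (rule simplicial_rmodule.chain_homology_module[OF K[OF that]])
  have NC_carrier: "z \<in> carrier (FK i n)" if "i \<in> I" "z \<in> NC i" for i z
    using that simplicial_rmodule.normalized_cycles_def[OF K] by (simp add: NC_def)
  have NC_cycle: "z \<in> carrier (simplicial_rmodule.cycle_module R (?lin i) n)" if "i \<in> I" "z \<in> NC i" for i z
    using that simplicial_rmodule.normalized_cycles_subset[OF K] by (auto simp: NC_def)
  have cls_hom: "cls i \<in> rmodule_hom R (simplicial_rmodule.cycle_module R (?lin i) n) (H i)" if "i \<in> I" for i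
    using simplicial_rmodule.homology_class_hom[OF K[OF that]] by (simp add: defs cls_def[abs_def])
  have cls_zero: "cls i z = \<zero>\<^bsub>H i\<^esub> \<longleftrightarrow> z \<in> NB i" if "i \<in> I" "z \<in> NC i" for i z
    using simplicial_rmodule.homology_class_eq_zero_iff[OF K] that by (simp add: defs)
  have cls_surj: "\<exists>z\<in>NC i. c = cls i z" if "i \<in> I" "c \<in> carrier (H i)" for i c
    using simplicial_rmodule.homology_class_normalized[OF K] that by (simp add: defs)
  have zero_NC: "\<zero>\<^bsub>FK i n\<^esub> \<in> NC i" if "i \<in> I" for i
    using subgroup.one_closed[OF submodule.axioms(1)[OF
        simplicial_rmodule.submodule_normalized_cycles[OF K[OF that]]]]
    by (simp add: NC_def)
  have cls_0: "cls i \<zero>\<^bsub>FK i n\<^esub> = \<zero>\<^bsub>H i\<^esub>" if "i \<in> I" for i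
    using rmodule_hom_zero[OF simplicial_rmodule.cycle_module_module[OF K[OF that]] mod_H[OF that]
        cls_hom[OF that]]
    by (simp add: simplicial_rmodule.cycle_module_def[OF K[OF that]])
  define Z where "Z = (smod_obj A n)\<lparr>carrier := A.normalized_cycles n\<rparr>"
  have mod_Z: "module R Z"
    unfolding Z_def
    by (rule submodule.submodule_is_module[OF A.submodule_normalized_cycles A.obj_module])
  \<comment> \<open>Vanishing of faces is tested on each component; in degree 0 there is nothing to
    test.\<close>
  have carrier_Z: "f \<in> carrier Z \<longleftrightarrow> f \<in> carrier (FL n) \<and> (\<forall>i\<in>I. res i n f \<in> NC i)" for f
  proof (cases n)
    case 0
    then show ?thesis
      using rmodule_hom_closed[OF res_hom]
      by (auto simp: Z_def A.normalized_cycles_def obj_A NC_def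
          simplicial_rmodule.normalized_cycles_def[OF K])
  next
    case (Suc m)
    have "smod_face A n j f = \<zero>\<^bsub>FL m\<^esub> \<longleftrightarrow>
        (\<forall>i\<in>I. smod_face (?lin i) n j (res i n f) = \<zero>\<^bsub>FK i m\<^esub>)"
      if "f \<in> carrier (FL n)" and "j \<le> n" for j
      using face_eq_zero_iff[of f m j] that Suc by (simp add: face_A)
    then show ?thesis
      using rmodule_hom_closed[OF res_hom] Suc
      by (auto simp: Z_def A.normalized_cycles_def obj_A NC_def
          simplicial_rmodule.normalized_cycles_def[OF K])
  qed
  define h where "h f = (\<lambda>i\<in>I. cls i (res i n f))" for f
  have hom: "h \<in> rmodule_hom R Z (direct_sum_module I H)"
  proof (rule rmodule_homI)
    fix f assume f: "f \<in> carrier Z"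
    have "{i \<in> I. h f i \<noteq> \<zero>\<^bsub>H i\<^esub>} \<subseteq> {i \<in> I. res i n f \<noteq> \<zero>\<^bsub>FK i n\<^esub>}"
      using cls_0 by (auto simp: h_def)
    moreover have "finite {i \<in> I. res i n f \<noteq> \<zero>\<^bsub>FK i n\<^esub>}"
      using f by (intro finite_res_nonzero) (simp add: carrier_Z)
    ultimately have "finite {i \<in> I. h f i \<noteq> \<zero>\<^bsub>H i\<^esub>}"
      by (rule finite_subset)
    moreover have "cls i (res i n f) \<in> carrier (H i)" if "i \<in> I" for i
      using f that rmodule_hom_closed[OF cls_hom NC_cycle] by (simp add: carrier_Z)
    ultimately show "h f \<in> carrier (direct_sum_module I H)"
      by (simp add: direct_sum_module_def h_def)
  next
    fix f g assume f: "f \<in> carrier Z" and g: "g \<in> carrier Z"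
    have "cls i (res i n (f \<oplus>\<^bsub>FL n\<^esub> g)) = cls i (res i n f) \<oplus>\<^bsub>H i\<^esub> cls i (res i n g)" if "i \<in> I" for i
    proof -
      have "res i n (f \<oplus>\<^bsub>FL n\<^esub> g) = res i n f \<oplus>\<^bsub>FK i n\<^esub> res i n g"
        using f g that by (intro rmodule_hom_add[OF res_hom]) (simp_all add: carrier_Z)
      moreover have "cls i (res i n f \<oplus>\<^bsub>FK i n\<^esub> res i n g) = cls i (res i n f) \<oplus>\<^bsub>H i\<^esub> cls i (res i n g)"
        using f g that rmodule_hom_add[OF cls_hom[OF that] NC_cycle[OF that] NC_cycle[OF that], of "res i n f" "res i n g"]
        by (simp add: carrier_Z simplicial_rmodule.cycle_module_def[OF K[OF that]])
      ultimately show ?thesis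
        by (simp only:)
    qed
    then show "h (f \<oplus>\<^bsub>Z\<^esub> g) = h f \<oplus>\<^bsub>direct_sum_module I H\<^esub> h g"
      by (simp add: h_def direct_sum_module_def Z_def obj_A cong: restrict_cong)
  next
    fix r f assume r: "r \<in> carrier R" and f: "f \<in> carrier Z"
    have "cls i (res i n (r \<odot>\<^bsub>FL n\<^esub> f)) = r \<odot>\<^bsub>H i\<^esub> cls i (res i n f)" if "i \<in> I" for i
    proof -
      have "res i n (r \<odot>\<^bsub>FL n\<^esub> f) = r \<odot>\<^bsub>FK i n\<^esub> res i n f"
        using f r that by (intro rmodule_hom_smult[OF res_hom]) (simp_all add: carrier_Z)
      moreover have "cls i (r \<odot>\<^bsub>FK i n\<^esub> res i n f) = r \<odot>\<^bsub>H i\<^esub> cls i (res i n f)"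
        using f that rmodule_hom_smult[OF cls_hom[OF that] r NC_cycle[OF that], of "res i n f"]
        by (simp add: carrier_Z simplicial_rmodule.cycle_module_def[OF K[OF that]])
      ultimately show ?thesis
        by (simp only:)
    qed
    then show "h (r \<odot>\<^bsub>Z\<^esub> f) = r \<odot>\<^bsub>direct_sum_module I H\<^esub> h f"
      by (simp add: h_def direct_sum_module_def Z_def obj_A cong: restrict_cong)
  qed
  have surj: "h ` carrier Z = carrier (direct_sum_module I H)"
  proof
    show "h ` carrier Z \<subseteq> carrier (direct_sum_module I H)"
      using rmodule_hom_closed[OF hom] by blast
    show "carrier (direct_sum_module I H) \<subseteq> h ` carrier Z"
    proof
      fix c assume c: "c \<in> carrier (direct_sum_module I H)"
      \<comment> \<open>Representing the zero class by zero makes the family z finitely supported,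
        as gluing demands.\<close>
      have "\<exists>z\<in>NC i. c i = cls i z \<and> (c i = \<zero>\<^bsub>H i\<^esub> \<longrightarrow> z = \<zero>\<^bsub>FK i n\<^esub>)" if i: "i \<in> I" for i
      proof (cases "c i = \<zero>\<^bsub>H i\<^esub>")
        case True
        then show ?thesis using cls_0[OF i] zero_NC[OF i] by auto
      next
        case False
        then show ?thesis
          using cls_surj[OF i, of "c i"] c i by (auto simp: direct_sum_module_def)
      qed
      then obtain z where z: "\<And>i. i \<in> I \<Longrightarrow> z i \<in> NC i" "\<And>i. i \<in> I \<Longrightarrow> c i = cls i (z i)"
        "\<And>i. \<lbrakk>i \<in> I; c i = \<zero>\<^bsub>H i\<^esub>\<rbrakk> \<Longrightarrow> z i = \<zero>\<^bsub>FK i n\<^esub>"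
        by metis
      have "finite {i \<in> I. z i \<noteq> \<zero>\<^bsub>FK i n\<^esub>}"
      proof (rule finite_subset)
        show "{i \<in> I. z i \<noteq> \<zero>\<^bsub>FK i n\<^esub>} \<subseteq> {i \<in> I. c i \<noteq> \<zero>\<^bsub>H i\<^esub>}"
          using z(3) by auto
        show "finite {i \<in> I. c i \<noteq> \<zero>\<^bsub>H i\<^esub>}"
          using c by (simp add: direct_sum_module_def)
      qed
      with z(1) NC_carrier obtain f where f: "f \<in> carrier (FL n)" "\<And>i. i \<in> I \<Longrightarrow> res i n f = z i"
        using coproduct_glue[of z n] by blast
      have "f \<in> carrier Z"
        using f z(1) by (simp add: carrier_Z)
      moreover have "h f = c"
      proof -
        have "h f = restrict c I"
          using f(2) z(2) by (simp add: h_def cong: restrict_cong)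
        also have "\<dots> = c"
          using c by (simp add: direct_sum_module_def PiE_iff extensional_restrict)
        finally show ?thesis .
      qed
      ultimately show "c \<in> h ` carrier Z"
        by blast
    qed
  qed
  \<comment> \<open>\<open>N\<close> and \<open>N'\<close> are the Moore differentials from degree n
    + 1 of the whole and of a component.\<close>
  define N where "N y = sgn_smult R (FL n) (Suc n) (smod_face A (Suc n) (Suc n) y)" for y
  define N' where "N' i y = sgn_smult R (FK i n) (Suc n) (smod_face (?lin i) (Suc n) (Suc n) y)" for i y
  have NB_A: "A.normalized_boundaries n =
      N ` {y \<in> carrier (FL (Suc n)). \<forall>j\<le>n. smod_face A (Suc n) j y = \<zero>\<^bsub>FL n\<^esub>}"
    by (simp add: A.normalized_boundaries_def N_def obj_A sgn_smult_def)
  have NB_K: "NB i = N' i ` {y \<in> carrier (FK i (Suc n)). \<forall>j\<le>n. smod_face (?lin i) (Suc n) j y = \<zero>\<^bsub>FK i n\<^esub>}"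
    if "i \<in> I" for i
    using simplicial_rmodule.normalized_boundaries_def[OF K[OF that]] by (simp add: NB_def N'_def)
  have face_A_closed: "smod_face A (Suc n) (Suc n) y \<in> carrier (FL n)" if "y \<in> carrier (FL (Suc n))" for y
    using A.d_closed[of "Suc n" n y] that by (simp add: obj_A)
  have N_closed: "N y \<in> carrier (FL n)" if "y \<in> carrier (FL (Suc n))" for y
    using module.sgn_smult_closed[OF R.free_module_module face_A_closed[OF that]] by (simp add: N_def)
  have res_N: "res i n (N y) = N' i (res i (Suc n) y)" if "i \<in> I" "y \<in> carrier (FL (Suc n))" for i y
    using that face_A_closed
    by (simp add: N_def N'_def res_sgn_smult) (simp add: face_A res_face)
  have norm_iff: "(\<forall>j\<le>n. smod_face A (Suc n) j y = \<zero>\<^bsub>FL n\<^esub>) \<longleftrightarrow>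
      (\<forall>i\<in>I. \<forall>j\<le>n. smod_face (?lin i) (Suc n) j (res i (Suc n) y) = \<zero>\<^bsub>FK i n\<^esub>)"
    if "y \<in> carrier (FL (Suc n))" for y
    using face_eq_zero_iff[OF that] by (auto simp: face_A)
  have h_zero_iff: "h f = \<zero>\<^bsub>direct_sum_module I H\<^esub> \<longleftrightarrow> (\<forall>i\<in>I. res i n f \<in> NB i)" if "f \<in> carrier Z" for f
    using that cls_zero by (auto simp: h_def direct_sum_module_def fun_eq_iff carrier_Z)
  have ker: "a_kernel Z (direct_sum_module I H) h = A.normalized_boundaries n"
  proof
    show "A.normalized_boundaries n \<subseteq> a_kernel Z (direct_sum_module I H) h"
    proof
      fix f assume f: "f \<in> A.normalized_boundaries n"
      then have f_Z: "f \<in> carrier Z"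
        using A.normalized_boundaries_subset by (auto simp: Z_def)
      obtain y where y: "y \<in> carrier (FL (Suc n))" "\<forall>j\<le>n. smod_face A (Suc n) j y = \<zero>\<^bsub>FL n\<^esub>" "f = N y"
        using f unfolding NB_A by blast
      have "res i n f \<in> NB i" if "i \<in> I" for i
        using y norm_iff[OF y(1)] that rmodule_hom_closed[OF res_hom]
        by (auto simp: NB_K res_N intro!: imageI)
      then show "f \<in> a_kernel Z (direct_sum_module I H) h"
        using f_Z h_zero_iff by (simp add: a_kernel_def')
    qed
    show "a_kernel Z (direct_sum_module I H) h \<subseteq> A.normalized_boundaries n"
    proof
      fix f assume "f \<in> a_kernel Z (direct_sum_module I H) h"
      then have f: "f \<in> carrier Z" and res_f: "\<And>i. i \<in> I \<Longrightarrow> res i n f \<in> NB i"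
        using h_zero_iff by (auto simp: a_kernel_def')
      \<comment> \<open>The same device for chains with a given boundary: zero is chosen where the
        restriction of f is zero, so the family y inherits finiteness from the restrictions of
        f.\<close>
      have "\<exists>y. y \<in> carrier (FK i (Suc n)) \<and> (\<forall>j\<le>n. smod_face (?lin i) (Suc n) j y = \<zero>\<^bsub>FK i n\<^esub>) \<and>
          res i n f = N' i y \<and> (res i n f = \<zero>\<^bsub>FK i n\<^esub> \<longrightarrow> y = \<zero>\<^bsub>FK i (Suc n)\<^esub>)" if i: "i \<in> I" for i
      proof (cases "res i n f = \<zero>\<^bsub>FK i n\<^esub>")
        case True
        interpret Ki: simplicial_rmodule R "?lin i" by (rule K[OF i])
        show ?thesis
          using True Ki.d_zero[of _ n] Ki.ob.M.zero_closed[of "Suc n"] Ki.ob.sgn_smult_r_zero[of n]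
          by (intro exI[of _ "\<zero>\<^bsub>FK i (Suc n)\<^esub>"]) (simp add: N'_def)
      next
        case False
        then show ?thesis
          using res_f[OF i] NB_K[OF i] by auto
      qed
      then obtain y where y: "\<And>i. i \<in> I \<Longrightarrow> y i \<in> carrier (FK i (Suc n))"
        "\<And>i. i \<in> I \<Longrightarrow> \<forall>j\<le>n. smod_face (?lin i) (Suc n) j (y i) = \<zero>\<^bsub>FK i n\<^esub>"
        "\<And>i. i \<in> I \<Longrightarrow> res i n f = N' i (y i)"
        "\<And>i. \<lbrakk>i \<in> I; res i n f = \<zero>\<^bsub>FK i n\<^esub>\<rbrakk> \<Longrightarrow> y i = \<zero>\<^bsub>FK i (Suc n)\<^esub>"
        by metis
      have "finite {i \<in> I. y i \<noteq> \<zero>\<^bsub>FK i (Suc n)\<^esub>}"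
      proof (rule finite_subset)
        show "{i \<in> I. y i \<noteq> \<zero>\<^bsub>FK i (Suc n)\<^esub>} \<subseteq> {i \<in> I. res i n f \<noteq> \<zero>\<^bsub>FK i n\<^esub>}"
          using y(4) by auto
        show "finite {i \<in> I. res i n f \<noteq> \<zero>\<^bsub>FK i n\<^esub>}"
          using f by (intro finite_res_nonzero) (simp add: carrier_Z)
      qed
      with y(1) obtain g where g: "g \<in> carrier (FL (Suc n))" "\<And>i. i \<in> I \<Longrightarrow> res i (Suc n) g = y i"
        using coproduct_glue[of y "Suc n"] by blast
      have "f = N g"
      proof (rule coproduct_ext)
        show "f \<in> carrier (FL n)" "N g \<in> carrier (FL n)"
          using f g N_closed by (simp_all add: carrier_Z)
        show "res i n f = res i n (N g)" if "i \<in> I" for i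
          using that g y(3) by (simp add: res_N)
      qed
      moreover have "\<forall>j\<le>n. smod_face A (Suc n) j g = \<zero>\<^bsub>FL n\<^esub>"
        using norm_iff[OF g(1)] g(2) y(2) by simp
      ultimately show "f \<in> A.normalized_boundaries n"
        unfolding NB_A using g(1) by blast
    qed
  qed
  have mod_D: "module R (direct_sum_module I H)"
    using mod_H by (rule direct_sum_module_module[OF cring])
  show ?thesis
    using first_isomorphism_module[OF mod_Z mod_D hom surj ker]
    by (simp add: A.moore_homology_eq Z_def H_def[abs_def])
qed

end


section \<open>Traces\<close>

abbreviation simplex_topology :: "nat \<Rightarrow> (nat \<Rightarrow> real) topology" where
  "simplex_topology n \<equiv> subtopology (powertop_real UNIV) (standard_simplex n)"

text \<open>Once a partial sum reaches index k, the merged entry makes it use one more entry of t.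
  At m = n it shows that the coordinates still sum to 1.\<close>

lemma sum_simplex_degen:
  "(\<Sum>j\<le>m. simplex_degen k t j) = (if m < k then \<Sum>j\<le>m. t j else \<Sum>j\<le>Suc m. t j)"
  by (induction m) (auto simp: simplex_degen_def less_Suc_eq)

lemma simplex_degen_in_standard_simplex:
  assumes "k \<le> n" "t \<in> standard_simplex (Suc n)"
  shows "simplex_degen k t \<in> standard_simplex n"
proof -
  have nonneg: "0 \<le> simplex_degen k t j" for j
    using assms by (auto simp: simplex_degen_def standard_simplex_def)
  have zero: "simplex_degen k t j = 0" if "j > n" for j
    using assms that by (auto simp: simplex_degen_def standard_simplex_def)
  have sum: "(\<Sum>j\<le>n. simplex_degen k t j) = 1"
    using assms by (simp add: sum_simplex_degen standard_simplex_def)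
  have "simplex_degen k t j \<le> 1" for j
  proof (cases "j \<le> n")
    case True
    then have "simplex_degen k t j \<le> (\<Sum>j\<le>n. simplex_degen k t j)"
      using nonneg by (intro member_le_sum) auto
    then show ?thesis using sum by simp
  qed (use zero in simp)
  then show ?thesis
    using nonneg zero sum by (simp add: standard_simplex_def)
qed

lemma continuous_map_simplex_degen:
  assumes "k \<le> n"
  shows "continuous_map (simplex_topology (Suc n)) (simplex_topology n) (simplex_degen k)"
proof -
  have "continuous_map (simplex_topology (Suc n)) euclideanreal (\<lambda>t. simplex_degen k t j)" for j
  proof -
    have "continuous_map (powertop_real UNIV) euclideanreal (\<lambda>t. t i)" for i :: nat
      by (rule continuous_map_product_projection) simp
    then show ?thesis
      by (auto simp: simplex_degen_def intro!: continuous_map_from_subtopology continuous_map_add)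
  qed
  then show ?thesis
    using simplex_degen_in_standard_simplex[OF assms]
    by (auto simp: continuous_map_in_subtopology continuous_map_componentwise_UNIV)
qed

lemma continuous_map_simplical_face:
  assumes "j \<le> Suc n"
  shows "continuous_map (simplex_topology n) (simplex_topology (Suc n)) (simplical_face j)"
proof -
  have "continuous_map (simplex_topology n) euclideanreal (\<lambda>t. simplical_face j t i)" for i
  proof -
    have "continuous_map (powertop_real UNIV) euclideanreal (\<lambda>t. t i)" for i :: nat
      by (rule continuous_map_product_projection) simp
    then show ?thesis
      by (auto simp: simplical_face_def intro!: continuous_map_from_subtopology)
  qed
  then show ?thesis
    using simplical_face_in_standard_simplex[of "Suc n" j] assms
    by (auto simp: continuous_map_in_subtopology continuous_map_componentwise_UNIV)
qed

text \<open>Points of simplices are functions on all natural numbers, so this and the following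
  identities are pointwise checks. The order of composition is opposite to that of the operators on
  paths, since precomposition reverses it.\<close>

lemma simplical_face_simplical_face:
  "i \<le> j \<Longrightarrow> simplical_face (Suc j) (simplical_face i t) = simplical_face i (simplical_face j t)"
  by (rule ext) (auto simp: simplical_face_def)

lemma simplex_degen_face_less:
  "i \<le> k \<Longrightarrow> simplex_degen (Suc k) (simplical_face i t) = simplical_face i (simplex_degen k t)"
  for t :: "nat \<Rightarrow> real"
  by (rule ext) (auto simp: simplical_face_def simplex_degen_def)

lemma simplex_degen_face_same: "simplex_degen k (simplical_face k t) = t"
  for t :: "nat \<Rightarrow> real"
  by (rule ext) (auto simp: simplical_face_def simplex_degen_def)

lemma simplex_degen_face_Suc: "simplex_degen k (simplical_face (Suc k) t) = t"
  for t :: "nat \<Rightarrow> real"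
  by (rule ext) (auto simp: simplical_face_def simplex_degen_def)

lemma simplex_degen_face_greater:
  "k < j \<Longrightarrow> simplex_degen k (simplical_face (Suc j) t) = simplical_face j (simplex_degen k t)"
  for t :: "nat \<Rightarrow> real"
  by (rule ext) (auto simp: simplical_face_def simplex_degen_def)

section \<open>Paths and traces under maps of simplices\<close>

text \<open>Faces and degeneracies are both of this form, so their compatibility with end points and
  reparametrization is proved once for a continuous \<theta>. The index i is that of the resulting
  path.\<close>

definition path_precomp :: "nat \<Rightarrow> ((nat \<Rightarrow> real) \<Rightarrow> nat \<Rightarrow> real) \<Rightarrow> 'a ipath \<Rightarrow> 'a ipath" where
  "path_precomp i \<theta> p = (\<lambda>(s, t)\<in>ipath_domain i. p (s, \<theta> t))"

lemma path_face_eq: "path_face i j = path_precomp i (simplical_face j)"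
  by (simp add: fun_eq_iff path_face_def path_precomp_def)

lemma path_degen_eq: "path_degen i k = path_precomp (Suc i) (simplex_degen k)"
  by (simp add: fun_eq_iff path_degen_def path_precomp_def)

lemma path_precomp_path_precomp:
  assumes "\<theta>' \<in> standard_simplex (i' - 1) \<rightarrow> standard_simplex (i - 1)"
  shows "path_precomp i' \<theta>' (path_precomp i \<theta> p) = path_precomp i' (\<lambda>t. \<theta> (\<theta>' t)) p"
  using assms by (auto simp: path_precomp_def fun_eq_iff)

lemma path_precomp_ident: "p \<in> ipaths X dX i \<Longrightarrow> path_precomp i (\<lambda>t. t) p = p"
  by (auto simp: path_precomp_def ipaths_def fun_eq_iff extensional_def)

text \<open>Some s is sent to 0 by surjectivity, and \<phi> 0 \<le> \<phi> s by monotonicity;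
  likewise at 1. Hence reparametrization keeps end points.\<close>

lemma surj_mono_endpoints:
  fixes \<phi> :: "real \<Rightarrow> real"
  assumes "mono_on {0..1} \<phi>" "\<phi> ` {0..1} = {0..1}"
  shows "\<phi> 0 = 0" "\<phi> 1 = 1"
proof -
  have range: "\<phi> s \<in> {0..1}" if "s \<in> {0..1}" for s
    using assms(2) that by blast
  obtain s where s: "s \<in> {0..1}" "\<phi> s = 0"
    using assms(2) by (metis atLeastAtMost_iff imageE order_refl zero_le_one)
  then have "\<phi> 0 \<le> 0"
    using mono_onD[OF assms(1), of 0 s] by simp
  then show "\<phi> 0 = 0"
    using range[of 0] by simp
  obtain s where s: "s \<in> {0..1}" "\<phi> s = 1"
    using assms(2) by (metis atLeastAtMost_iff imageE order_refl zero_le_one)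
  then have "1 \<le> \<phi> 1"
    using mono_onD[OF assms(1), of s 1] by simp
  then show "\<phi> 1 = 1"
    using range[of 1] by simp
qed

context d_space
begin

text \<open>The slice at t is the slice of p at \<theta> t, hence a d-path.\<close>

lemma path_precomp_ipaths:
  assumes \<theta>: "continuous_map (simplex_topology (i' - 1)) (simplex_topology (i - 1)) \<theta>"
    and p: "p \<in> ipaths X dX i"
  shows "path_precomp i' \<theta> p \<in> ipaths X dX i'"
proof -
  have \<theta>_in: "\<theta> t \<in> standard_simplex (i - 1)" if "t \<in> standard_simplex (i' - 1)" for t
    using \<theta> that by (auto simp: continuous_map_def)
  let ?D = "\<lambda>i. prod_topology (top_of_set {0..1::real}) (simplex_topology (i - 1))"
  have "continuous_map (?D i') (?D i) (\<lambda>x. (fst x, \<theta> (snd x)))"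
    using \<theta> continuous_map_compose[OF continuous_map_snd \<theta>]
    by (intro continuous_map_pairedI continuous_map_fst) (simp_all add: o_def)
  then have "continuous_map (?D i') X (p \<circ> (\<lambda>x. (fst x, \<theta> (snd x))))"
    using p by (intro continuous_map_compose) (auto simp: ipaths_def)
  then have "continuous_map (?D i') X (path_precomp i' \<theta> p)"
    by (rule continuous_map_eq) (auto simp: path_precomp_def)
  moreover have "(\<lambda>s\<in>{0..1}. path_precomp i' \<theta> p (s, t)) \<in> dX" if t: "t \<in> standard_simplex (i' - 1)" for t
  proof -
    have "(\<lambda>s\<in>{0..1}. path_precomp i' \<theta> p (s, t)) = (\<lambda>s\<in>{0..1}. p (s, \<theta> t))"
      using t by (auto simp: path_precomp_def fun_eq_iff)
    then show ?thesis
      using p \<theta>_in[OF t] by (simp add: ipaths_def)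
  qed
  ultimately show ?thesis
    by (simp add: ipaths_def path_precomp_def)
qed

lemma path_precomp_ipaths_between:
  assumes \<theta>: "continuous_map (simplex_topology (i' - 1)) (simplex_topology (i - 1)) \<theta>"
    and p: "p \<in> ipaths_between X dX i a b"
  shows "path_precomp i' \<theta> p \<in> ipaths_between X dX i' a b"
proof -
  have "\<theta> t \<in> standard_simplex (i - 1)" if "t \<in> standard_simplex (i' - 1)" for t
    using \<theta> that by (auto simp: continuous_map_def)
  then show ?thesis
    using p path_precomp_ipaths[OF \<theta>] by (auto simp: ipaths_between_def path_precomp_def)
qed

text \<open>The two operations act on different coordinates, so the same \<phi> works.\<close>

lemma reparam_path_precomp:
  assumes \<theta>: "continuous_map (simplex_topology (i' - 1)) (simplex_topology (i - 1)) \<theta>"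
    and "reparam X dX i p q"
  shows "reparam X dX i' (path_precomp i' \<theta> p) (path_precomp i' \<theta> q)"
proof -
  have \<theta>_in: "\<theta> t \<in> standard_simplex (i - 1)" if "t \<in> standard_simplex (i' - 1)" for t
    using \<theta> that by (auto simp: continuous_map_def)
  obtain \<phi> where p: "p \<in> ipaths X dX i" and \<phi>: "continuous_on {0..1} \<phi>" "mono_on {0..1} \<phi>"
    and surj: "\<phi> ` {0..1::real} = {0..1}" and q: "q = (\<lambda>(s, t)\<in>ipath_domain i. p (\<phi> s, t))"
    using assms(2) by (auto simp: reparam_def)
  have "\<phi> s \<in> {0..1}" if "s \<in> {0..1}" for s
    using surj that by blast
  then have "path_precomp i' \<theta> q = (\<lambda>(s, t)\<in>ipath_domain i'. path_precomp i' \<theta> p (\<phi> s, t))"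
    using \<theta>_in by (auto simp: q path_precomp_def fun_eq_iff)
  then show ?thesis
    using path_precomp_ipaths[OF \<theta> p] \<phi> surj unfolding reparam_def by blast
qed

text \<open>\<open>reparam\<close> demands an i-path only on its left; closure of d-paths under
  reparametrization gives the right side, so that the generated equivalence can be followed in both
  directions.\<close>

lemma reparam_ipaths:
  assumes "reparam X dX i p q"
  shows "q \<in> ipaths X dX i"
proof -
  obtain \<phi> where p: "p \<in> ipaths X dX i" and \<phi>: "continuous_on {0..1} \<phi>" "mono_on {0..1} \<phi>"
    and surj: "\<phi> ` {0..1::real} = {0..1}" and q: "q = (\<lambda>(s, t)\<in>ipath_domain i. p (\<phi> s, t))"
    using assms by (auto simp: reparam_def)
  have range: "\<phi> \<in> {0..1} \<rightarrow> {0..1}"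
    using surj by blast
  let ?D = "prod_topology (top_of_set {0..1::real}) (simplex_topology (i - 1))"
  have \<phi>_cont: "continuous_map (top_of_set {0..1}) (top_of_set {0..1}) \<phi>"
    using \<phi>(1) range by (auto simp: continuous_map_in_subtopology)
  have "continuous_map ?D ?D (\<lambda>x. (\<phi> (fst x), snd x))"
    using continuous_map_compose[OF continuous_map_fst \<phi>_cont]
    by (intro continuous_map_pairedI continuous_map_snd) (simp_all add: o_def)
  then have "continuous_map ?D X (p \<circ> (\<lambda>x. (\<phi> (fst x), snd x)))"
    using p by (intro continuous_map_compose) (auto simp: ipaths_def)
  then have "continuous_map ?D X q"
    by (rule continuous_map_eq) (auto simp: q)
  moreover have "(\<lambda>s\<in>{0..1}. q (s, t)) \<in> dX" if t: "t \<in> standard_simplex (i - 1)" for t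
  proof -
    have "(\<lambda>s\<in>{0..1}. (\<lambda>s\<in>{0..1}. p (s, t)) (\<phi> s)) \<in> dX"
      using p t by (intro dpath_reparam[OF _ \<phi> range]) (simp add: ipaths_def del: restrict_apply)
    moreover have "(\<lambda>s\<in>{0..1}. (\<lambda>s\<in>{0..1}. p (s, t)) (\<phi> s)) = (\<lambda>s\<in>{0..1}. q (s, t))"
      using t range by (intro restrict_ext) (auto simp: q Pi_iff)
    ultimately show ?thesis by simp
  qed
  ultimately show ?thesis
    by (simp add: ipaths_def q)
qed

lemma reparam_ipaths_between:
  assumes "reparam X dX i p q"
  shows "p \<in> ipaths_between X dX i a b \<longleftrightarrow> q \<in> ipaths_between X dX i a b"
proof -
  obtain \<phi> where p: "p \<in> ipaths X dX i" and \<phi>: "mono_on {0..1} \<phi>" "\<phi> ` {0..1::real} = {0..1}"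
    and q: "q = (\<lambda>(s, t)\<in>ipath_domain i. p (\<phi> s, t))"
    using assms by (auto simp: reparam_def)
  show ?thesis
    using p reparam_ipaths[OF assms] surj_mono_endpoints[OF \<phi>]
    by (auto simp: ipaths_between_def q)
qed

lemma equivclp_reparam_ipaths_between:
  "equivclp (reparam X dX i) p q \<Longrightarrow> p \<in> ipaths_between X dX i a b \<longleftrightarrow> q \<in> ipaths_between X dX i a b"
  by (induction rule: equivclp_induct) (use reparam_ipaths_between in blast)+

lemma trace_of_eq: "equivclp (reparam X dX i) p q \<Longrightarrow> trace_of X dX i p = trace_of X dX i q"
  unfolding trace_of_def by (intro Collect_cong) (meson equivclp_sym equivclp_trans)

lemma self_in_trace_of: "p \<in> trace_of X dX i p"
  by (simp add: trace_of_def)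

lemma equivclp_reparam_path_precomp:
  assumes \<theta>: "continuous_map (simplex_topology (i' - 1)) (simplex_topology (i - 1)) \<theta>"
  shows "equivclp (reparam X dX i) p q
    \<Longrightarrow> equivclp (reparam X dX i') (path_precomp i' \<theta> p) (path_precomp i' \<theta> q)"
proof (induction rule: equivclp_induct)
  case (step q r)
  then show ?case
    using reparam_path_precomp[OF \<theta>] by (blast intro: equivclp_into_equivclp)
qed simp

text \<open>All members of the class contribute the same class, and there is at least one; so the
  union is a single class and induced maps can be computed on a representative.\<close>

lemma trace_precomp_trace_of:
  assumes "continuous_map (simplex_topology (i' - 1)) (simplex_topology (i - 1)) \<theta>"
  shows "(\<Union>q\<in>trace_of X dX i p. trace_of X dX i' (path_precomp i' \<theta> q)) =
    trace_of X dX i' (path_precomp i' \<theta> p)"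
proof -
  have "trace_of X dX i' (path_precomp i' \<theta> q) = trace_of X dX i' (path_precomp i' \<theta> p)"
    if "q \<in> trace_of X dX i p" for q
    using that equivclp_reparam_path_precomp[OF assms, of p q] trace_of_eq by (auto simp: trace_of_def[of _ _ i])
  then show ?thesis
    using self_in_trace_of by blast
qed

lemma trace_face_trace_of:
  assumes "j \<le> Suc n"
  shows "trace_face X dX (Suc n) j (trace_of X dX (Suc (Suc n)) p) =
    trace_of X dX (Suc n) (path_precomp (Suc n) (simplical_face j) p)"
  unfolding trace_face_def path_face_eq
  using continuous_map_simplical_face[OF assms] by (intro trace_precomp_trace_of) simp

lemma trace_degen_trace_of:
  assumes "k \<le> n"
  shows "trace_degen X dX (Suc n) k (trace_of X dX (Suc n) p) =
    trace_of X dX (Suc (Suc n)) (path_precomp (Suc (Suc n)) (simplex_degen k) p)"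
  unfolding trace_degen_def path_degen_eq
  using continuous_map_simplex_degen[OF assms] by (intro trace_precomp_trace_of) simp

section \<open>Simplicial sets of traces and their end points\<close>

text \<open>One statement for two uses: all pairs of points give the set of all traces, a single
  pair gives ST(X)(a,b).\<close>

lemma simplicial_set_traces:
  fixes W :: "('a \<times> 'a) set"
  shows "simplicial_set (trace_simplicial_set X dX (\<lambda>i. \<Union>(a, b)\<in>W. traces X dX i a b))" (is "simplicial_set ?K")
proof -
  have cases: "\<exists>p a b. x = trace_of X dX (Suc n) p \<and> p \<in> ipaths_between X dX (Suc n) a b \<and> (a, b) \<in> W"
    if "x \<in> simplices ?K n" for x n
    using that by (auto simp: trace_simplicial_set_def traces_def)
  have memI: "trace_of X dX (Suc n) p \<in> simplices ?K n"
    if "p \<in> ipaths_between X dX (Suc n) a b" "(a, b) \<in> W" for p n a b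
    using that by (auto simp: trace_simplicial_set_def traces_def)
  have face: "sset_face ?K (Suc n) j (trace_of X dX (Suc (Suc n)) p) =
      trace_of X dX (Suc n) (path_precomp (Suc n) (simplical_face j) p)" if "j \<le> Suc n" for n j p
    using trace_face_trace_of[OF that] by (simp add: trace_simplicial_set_def)
  have degen: "sset_degen ?K n k (trace_of X dX (Suc n) p) =
      trace_of X dX (Suc (Suc n)) (path_precomp (Suc (Suc n)) (simplex_degen k) p)" if "k \<le> n" for n k p
    using trace_degen_trace_of[OF that] by (simp add: trace_simplicial_set_def)
  have face_in: "simplical_face j \<in> standard_simplex n \<rightarrow> standard_simplex (Suc n)" if "j \<le> Suc n" for j n
    using simplical_face_in_standard_simplex[of "Suc n" j] that by auto
  have degen_in: "simplex_degen k \<in> standard_simplex (Suc n) \<rightarrow> standard_simplex n" if "k \<le> n" for k n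
    using simplex_degen_in_standard_simplex[OF that] by auto
  show ?thesis
  proof
    fix x n j assume x: "x \<in> simplices ?K (Suc n)" and j: "j \<le> Suc n"
    obtain p a b where "x = trace_of X dX (Suc (Suc n)) p" "p \<in> ipaths_between X dX (Suc (Suc n)) a b"
      "(a, b) \<in> W"
      using cases[OF x] by blast
    then show "sset_face ?K (Suc n) j x \<in> simplices ?K n"
      using j path_precomp_ipaths_between[of "Suc n" "Suc (Suc n)" "simplical_face j"]
        continuous_map_simplical_face[OF j]
      by (auto simp: face intro!: memI)
  next
    fix x n k assume x: "x \<in> simplices ?K n" and k: "k \<le> n"
    obtain p a b where "x = trace_of X dX (Suc n) p" "p \<in> ipaths_between X dX (Suc n) a b" "(a, b) \<in> W"
      using cases[OF x] by blast
    then show "sset_degen ?K n k x \<in> simplices ?K (Suc n)"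
      using k path_precomp_ipaths_between[of "Suc (Suc n)" "Suc n" "simplex_degen k"]
        continuous_map_simplex_degen[OF k]
      by (auto simp: degen intro!: memI)
  next
    fix x n i j assume "i \<le> j" "j \<le> Suc n" and x: "x \<in> simplices ?K (Suc (Suc n))"
    then show "sset_face ?K (Suc n) i (sset_face ?K (Suc (Suc n)) (Suc j) x) =
        sset_face ?K (Suc n) j (sset_face ?K (Suc (Suc n)) i x)"
      using cases[OF x]
      by (auto simp: face path_precomp_path_precomp face_in simplical_face_simplical_face)
  next
    fix x n i k assume "i \<le> k" "k \<le> n" and x: "x \<in> simplices ?K (Suc n)"
    then show "sset_face ?K (Suc (Suc n)) i (sset_degen ?K (Suc n) (Suc k) x) =
        sset_degen ?K n k (sset_face ?K (Suc n) i x)"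
      using cases[OF x]
      by (auto simp: face degen path_precomp_path_precomp face_in degen_in simplex_degen_face_less)
  next
    fix x n k assume "k \<le> n" and x: "x \<in> simplices ?K n"
    then show "sset_face ?K (Suc n) k (sset_degen ?K n k x) = x"
      "sset_face ?K (Suc n) (Suc k) (sset_degen ?K n k x) = x"
      using cases[OF x]
      by (auto simp: face degen path_precomp_path_precomp face_in simplex_degen_face_same
          simplex_degen_face_Suc path_precomp_ident ipaths_between_def)
  next
    fix x n k j assume "k < j" "j \<le> Suc n" and x: "x \<in> simplices ?K (Suc n)"
    then show "sset_face ?K (Suc (Suc n)) (Suc j) (sset_degen ?K (Suc n) k x) =
        sset_degen ?K n k (sset_face ?K (Suc n) j x)"
      using cases[OF x]
      by (auto simp: face degen path_precomp_path_precomp face_in degen_in simplex_degen_face_greater)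
  qed
qed

text \<open>Equivalent paths have the same end points, and these are read off at a point of the
  nonempty simplex. This yields disjointness of the components.\<close>

lemma traces_endpoints_unique:
  assumes "P \<in> traces X dX i a b" "P \<in> traces X dX i a' b'"
  shows "a = a'" "b = b'"
proof -
  obtain p p' where p: "p \<in> ipaths_between X dX i a b" "P = trace_of X dX i p"
    and p': "p' \<in> ipaths_between X dX i a' b'" "P = trace_of X dX i p'"
    using assms by (auto simp: traces_def)
  then have "equivclp (reparam X dX i) p p'"
    using self_in_trace_of[of p' i] by (simp add: trace_of_def)
  then have "p \<in> ipaths_between X dX i a' b'"
    using p'(1) equivclp_reparam_ipaths_between by blast
  moreover obtain t where "t \<in> standard_simplex (i - 1)"
    using nonempty_standard_simplex by blast
  ultimately show "a = a'" "b = b'"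
    using p(1) by (auto simp: ipaths_between_def)
qed

lemma trace_start_eq: "P \<in> traces X dX i a b \<Longrightarrow> trace_start X dX i P = a"
  unfolding trace_start_def using traces_endpoints_unique by blast

lemma trace_end_eq: "P \<in> traces X dX i a b \<Longrightarrow> trace_end X dX i P = b"
  unfolding trace_end_def using traces_endpoints_unique by blast

text \<open>Any slice will do. This connects traces of every degree with the hypothesis on S, which
  speaks of d-paths.\<close>

lemma traces_imp_dpath:
  assumes "P \<in> traces X dX i a b"
  shows "\<exists>c\<in>dX. c 0 = a \<and> c 1 = b"
proof -
  obtain p where p: "p \<in> ipaths_between X dX i a b"
    using assms by (auto simp: traces_def)
  obtain t where "t \<in> standard_simplex (i - 1)"
    using nonempty_standard_simplex by blast
  with p show ?thesis
    by (intro bexI[of _ "\<lambda>s\<in>{0..1}. p (s, t)"]) (auto simp: ipaths_between_def ipaths_def)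
qed

end

theorem proposition2:
  fixes X :: "'a topology" and dX :: "(real \<Rightarrow> 'a) set"
    and R :: "('r, 'e) ring_scheme" and n :: nat and S :: "'a trace set"
  assumes "d_space X dX"
    and "cring R"
    and "n \<ge> 1"
    and "S \<subseteq> all_traces X dX 1"
    and "\<And>a b. \<lbrakk>a \<in> topspace X; b \<in> topspace X; \<exists>c\<in>dX. c 0 = a \<and> c 1 = b\<rbrakk>
      \<Longrightarrow> \<exists>!P. P \<in> S \<and> P \<in> traces X dX 1 a b"
  shows "isomorphic_modules R (HA R X dX n) (direct_sum_module S (HN R X dX n))"
proof -
  interpret d_space X dX by fact
  define L where "L = trace_simplicial_set X dX (all_traces X dX)"
  define K where "K P = ST X dX (trace_start X dX 1 P) (trace_end X dX 1 P)" for P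
  have S_traces: "\<exists>a\<in>topspace X. \<exists>b\<in>topspace X. P \<in> traces X dX 1 a b" if "P \<in> S" for P
    using that assms(4) unfolding all_traces_def by blast
  interpret simplicial_coproduct R L S K
  proof (rule simplicial_coproduct.intro)
    show "cring R" by fact
    have "all_traces X dX = (\<lambda>i. \<Union>(a, b)\<in>topspace X \<times> topspace X. traces X dX i a b)"
      by (auto simp: all_traces_def fun_eq_iff)
    then show "simplicial_set L"
      using simplicial_set_traces[of "topspace X \<times> topspace X"] by (simp add: L_def)
    show "simplicial_set (K P)" for P
      using simplicial_set_traces[of "{(trace_start X dX 1 P, trace_end X dX 1 P)}"]
      by (simp add: K_def ST_def)
    show "sset_face (K P) = sset_face L" for P
      by (simp add: K_def L_def ST_def trace_simplicial_set_def)
    show "simplices L m = (\<Union>P\<in>S. simplices (K P) m)" for m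
    proof
      show "simplices L m \<subseteq> (\<Union>P\<in>S. simplices (K P) m)"
      proof
        fix Q assume "Q \<in> simplices L m"
        then obtain a b where ab: "a \<in> topspace X" "b \<in> topspace X" and Q: "Q \<in> traces X dX (Suc m) a b"
          by (auto simp: L_def trace_simplicial_set_def all_traces_def)
        \<comment> \<open>Q has degree m, but a slice of it is a d-path from a to b, so S contains a
          1-trace with the same end points.\<close>
        obtain P where "P \<in> S" "P \<in> traces X dX 1 a b"
          using assms(5)[OF ab traces_imp_dpath[OF Q]] by blast
        with Q show "Q \<in> (\<Union>P\<in>S. simplices (K P) m)"
          by (intro UN_I[of P])
            (simp_all add: K_def ST_def trace_simplicial_set_def trace_start_eq trace_end_eq)
      qed
      show "(\<Union>P\<in>S. simplices (K P) m) \<subseteq> simplices L m"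
      proof clarify
        fix Q P assume P: "P \<in> S" and Q: "Q \<in> simplices (K P) m"
        obtain a b where "a \<in> topspace X" "b \<in> topspace X" "P \<in> traces X dX 1 a b"
          using S_traces[OF P] by blast
        with Q show "Q \<in> simplices L m"
          by (auto simp: K_def L_def ST_def trace_simplicial_set_def all_traces_def trace_start_eq
              trace_end_eq)
      qed
    qed
    show "P = P'" if P: "P \<in> S" "P' \<in> S" and Q: "Q \<in> simplices (K P) m" "Q \<in> simplices (K P') m"
      for P P' Q m
    proof -
      obtain a b where ab: "a \<in> topspace X" "b \<in> topspace X" "P \<in> traces X dX 1 a b"
        using S_traces[OF P(1)] by blast
      obtain a' b' where ab': "P' \<in> traces X dX 1 a' b'"
        using S_traces[OF P(2)] by blast
      have "Q \<in> traces X dX (Suc m) a b" "Q \<in> traces X dX (Suc m) a' b'"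
        using Q ab(3) ab' by (simp_all add: K_def ST_def trace_simplicial_set_def trace_start_eq trace_end_eq)
      then have "a' = a" "b' = b"
        using traces_endpoints_unique by blast+
      \<comment> \<open>P and P' are now both 1-traces from a to b in S, so the uniqueness part of
        the assumption identifies them.\<close>
      with ab' assms(5)[OF ab(1,2) traces_imp_dpath[OF ab(3)]] ab(3) P show ?thesis
        by blast
    qed
  qed
  \<comment> \<open>The product in simplicial degree m is the concatenation of (m + 1)-traces, which
    becomes the parameter \<mu>.\<close>
  have "HA R X dX n = moore_homology R ((linearization R L)\<lparr>smod_obj := \<lambda>m.
      (smod_obj (linearization R L) m)\<lparr>mult := trace_algebra_mult R X dX (Suc m)\<rparr>\<rparr>) (n - 1)"
    by (simp add: HA_def trace_simplicial_algebra_def L_def Let_def)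
  moreover have "HN R X dX n = (\<lambda>P. simplicial_homology R (K P) (n - 1))"
    by (simp add: fun_eq_iff HN_def K_def)
  ultimately show ?thesis
    using moore_homology_coproduct by simp
qed

end
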